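(* Let $Q$ be a bounded convex $L$-embedded subset of a Banach space $X$ and let $(S,(Q,\mathrm{weak}))$ be a nonexpansive and norm-distal dynamical system. If $Q$ contains a nonempty bounded subset $A$ such that $s(A)=A$ for all $s\in S$, then there is a fixed point of $S$ in $E_Q(A)$, i.e. a point $x\in E_Q(A)$ with $sx=x$ for every $s\in S$.
   Context: A nonempty subset $C$ of a Banach space $X$ is $L$-embedded if there is a subspace $X_s$ of $X^{**}$ such that $X\oplus_1X_s\subset X^{**}$ (i.e. the sum of the canonical image of $X$ and $X_s$ is direct and $\|x+\xi\|=\|x\|+\|\xi\|$ for $x\in X$, $\xi\in X_s$) and $\overline{C}^{\mathrm{wk}^{*}}\subset C\oplus_1X_s=\{c+\xi:c\in C,\ \xi\in X_s\}$, where $\overline{C}^{\mathrm{wk}^{*}}$ is the closure of $C$ in $X^{**}$ in the weak$^{*}$ topology of $X^{**}$. For $A,C\subset X$ with $A$ bounded, the Chebyshev radius of $A$ in $C$ is $r_C(A)=\inf_{x\in C}\sup_{y\in A}\|x-y\|$ and the Chebyshev center of $A$ in $C$ is $E_C(A)=\{x\in C:\sup_{y\in A}\|x-y\|=r_C(A)\}$. A dynamical system $(S,(Q,\mathrm{weak}))$ consists of a semigroup $S$ and a semigroup action $S\times Q\to Q$, $(s,x)\mapsto sx$ (so $(st)x=s(tx)$), such that for each $s\in S$ the map $x\mapsto sx$ is continuous from $Q$ with the weak topology to itself. It is nonexpansive if $\|sx-sy\|\le\|x-y\|$ for all $s\in S$, $x,y\in Q$, and norm-distal if for every pair of distinct $x,y\in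 Q$, $0$ does not belong to the norm closure of $\{sx-sy:s\in S\}$. We write $s(A)=\{sa:a\in A\}$. *)

theory Defs
  imports "HOL-Analysis.Analysis"
begin

type_synonym 'a dual = "'a \<Rightarrow>\<^sub>L real"
type_synonym 'a bidual = "'a dual \<Rightarrow>\<^sub>L real"

lift_definition bidual_embedding :: "'a::real_normed_vector \<Rightarrow> 'a bidual"
  is "\<lambda>x f. blinfun_apply f x"
  by (rule blinfun.bounded_linear_left)

text \<open>The initial topology with respect to all bounded linear functionals:
  \<open>euclidean\<close> on the function type \<open>'a dual \<Rightarrow> real\<close> is the product topology.\<close>

definition weak_topology :: "'a::real_normed_vector topology" where
  "weak_topology = pullback_topology UNIV (\<lambda>x (f::'a dual). blinfun_apply f x) euclidean"

text \<open>On real-valued functionals the strong operator topology is the topology of pointwise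
  convergence, so on the bidual it is the weak* topology induced by the dual.\<close>

abbreviation bidual_weak_star :: "'a::real_normed_vector bidual topology" where
  "bidual_weak_star \<equiv> strong_operator_topology"

definition L_embedded :: "'a::real_normed_vector set \<Rightarrow> bool" where
  "L_embedded C \<longleftrightarrow> C \<noteq> {} \<and>
    (\<exists>Xs :: 'a bidual set. subspace Xs \<and>
      range bidual_embedding \<inter> Xs = {0} \<and>
      (\<forall>x. \<forall>\<xi>\<in>Xs. norm (bidual_embedding x + \<xi>) = norm x + norm \<xi>) \<and>
      bidual_weak_star closure_of (bidual_embedding ` C)
        \<subseteq> {bidual_embedding c + \<xi> |c \<xi>. c \<in> C \<and> \<xi> \<in> Xs})"

text \<open>The infimum and supremum are taken in the reals; they are meaningful only for nonempty
  \<open>C\<close> and nonempty bounded \<open>A\<close>.\<close>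

definition chebyshev_radius :: "'a::real_normed_vector set \<Rightarrow> 'a set \<Rightarrow> real" where
  "chebyshev_radius C A = (INF x\<in>C. SUP y\<in>A. norm (x - y))"

definition chebyshev_center :: "'a::real_normed_vector set \<Rightarrow> 'a set \<Rightarrow> 'a set" where
  "chebyshev_center C A = {x \<in> C. (SUP y\<in>A. norm (x - y)) = chebyshev_radius C A}"

text \<open>The semigroup is the whole type \<open>'s\<close>. The action is a total function of which only the
  values on \<open>Q\<close> matter; \<open>Q\<close> is mapped to itself because \<open>continuous_map\<close> requires it.\<close>

definition weak_dynamical_system ::
    "('s::semigroup_mult \<Rightarrow> 'a::real_normed_vector \<Rightarrow> 'a) \<Rightarrow> 'a set \<Rightarrow> bool" where
  "weak_dynamical_system act Q \<longleftrightarrow>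
    (\<forall>s t. \<forall>x\<in>Q. act (s * t) x = act s (act t x)) \<and>
    (\<forall>s. continuous_map (subtopology weak_topology Q) (subtopology weak_topology Q) (act s))"

definition nonexpansive_action ::
    "('s \<Rightarrow> 'a::real_normed_vector \<Rightarrow> 'a) \<Rightarrow> 'a set \<Rightarrow> bool" where
  "nonexpansive_action act Q \<longleftrightarrow>
    (\<forall>s. \<forall>x\<in>Q. \<forall>y\<in>Q. norm (act s x - act s y) \<le> norm (x - y))"

definition norm_distal_action ::
    "('s \<Rightarrow> 'a::real_normed_vector \<Rightarrow> 'a) \<Rightarrow> 'a set \<Rightarrow> bool" where
  "norm_distal_action act Q \<longleftrightarrow>
    (\<forall>x\<in>Q. \<forall>y\<in>Q. x \<noteq> y \<longrightarrow> 0 \<notin> closure {act s x - act s y |s. True})"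

lemma topspace_weak_topology [simp]: "topspace weak_topology = UNIV"
  by (simp add: weak_topology_def topspace_pullback_topology)

end

theory Submission
  imports Defs
begin

text \<open>The Chebyshev center \<open>E\<close> of \<open>A\<close> in \<open>Q\<close> is convex, and it is mapped to itself by every \<open>s\<close>: each point
of \<open>A\<close> is \<open>s y'\<close> for some \<open>y'\<close> in \<open>A\<close>, so \<open>s x\<close> is no farther from \<open>A\<close> than \<open>x\<close>. Being
\<open>L\<close>-embedded makes \<open>E\<close> nonempty and weakly compact. Indeed, let \<open>c + \<xi>\<close> be a weak* limit of
points of \<open>Q\<close> at distance at most \<open>t\<close> from every \<open>y\<close> in \<open>A\<close>. Weak* lower semicontinuity of the
norm and the \<open>1\<close>-sum give \<open>norm (c - y) + norm \<xi> \<le> t\<close>, so passing from the limit to its part \<open>c\<close>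
in \<open>Q\<close> loses nothing; and if \<open>t\<close> is the Chebyshev radius, then \<open>\<xi>\<close> must vanish. Both claims
follow with the Banach-Alaoglu theorem (\<open>L_embedded_sublevel_weakly_compact\<close>).

It remains to find a common fixed point in \<open>E\<close>. Fixed point sets of single elements are weakly
closed, so by compactness finitely many elements at a time suffice, and these generate a countable
semigroup \<open>\<T>\<close>. Take a minimal closed convex invariant \<open>M\<close> inside \<open>E\<close>, and a minimal closed
invariant \<open>F\<close> inside \<open>M\<close>. The following facts show that \<open>F\<close> is a single point, which is then
fixed.

\<^item> \<open>F\<close> is norm separable, being the weak closure of a countable orbit. By Baire's theorem it has
  nonempty relatively weakly open subsets of arbitrarily small norm diameter
  (\<open>minimal_small_open\<close>).

\<^item> Hence norm-distality implies distality for the weak topology: were two points proximal, some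
  element of \<open>\<T>\<close> would move them into such a small set (\<open>minimal_proximal_imp_eq\<close>).

\<^item> By Ellis' idempotent argument every \<open>s\<close> in \<open>\<T>\<close> is then simultaneously recurrent on each pair of
  points of \<open>F\<close> (\<open>distal_map_recurrent\<close>). A recurrent nonexpansive map is an isometry of \<open>F\<close> onto
  \<open>F\<close> (\<open>minimal_isometry\<close>, \<open>minimal_surj\<close>).

\<^item> Finitely many preimages of a small set cover \<open>F\<close> by minimality, and preimages under isometries
  are again small, so \<open>F\<close> is totally bounded (\<open>minimal_finite_net\<close>).

\<^item> If \<open>F\<close> had diameter \<open>d > 0\<close>, the average of a finite \<open>d / 2\<close>-net would be a point of \<open>M\<close> at
  distance at most some \<open>r < d\<close> from all of \<open>F\<close>. The points of \<open>M\<close> with this property form a closed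
  convex set, invariant because \<open>s F = F\<close>, so they are all of \<open>M\<close>; in particular any two points of
  \<open>F\<close> are within \<open>r\<close>, a contradiction (\<open>common_fixed_point\<close>).

Separability of \<open>F\<close> uses that norm closed subspaces are weakly closed; like the weak lower
semicontinuity of the norm, this comes from the Hahn-Banach theorem.\<close>

section \<open>Minimal closed sets and idempotents\<close>

text \<open>Zorn's lemma, with compactness making the intersection of a chain nonempty. The property \<open>P\<close> only
has to pass to intersections that are already known to be nonempty.\<close>

lemma minimal_nonempty_closed_set:
  assumes X: "compact_space X" and K: "P K"
    and closed: "\<And>C. P C \<Longrightarrow> closedin X C \<and> C \<noteq> {}"
    and Inter: "\<And>\<C>. \<C> \<noteq> {} \<Longrightarrow> (\<And>C. C \<in> \<C> \<Longrightarrow> P C) \<Longrightarrow> \<Inter>\<C> \<noteq> {} \<Longrightarrow> P (\<Inter>\<C>)"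
  obtains M where "P M" "M \<subseteq> K" "\<And>C. P C \<Longrightarrow> C \<subseteq> M \<Longrightarrow> C = M"
proof -
  define A where "A = {C. P C \<and> C \<subseteq> K}"
  have "\<exists>M\<in>A. \<forall>C\<in>A. M \<supseteq> C \<longrightarrow> C = M"
  proof (rule predicate_Zorn)
    show "partial_order_on A (relation_of (\<supseteq>) A)"
      by (rule partial_order_on_relation_ofI) auto
    fix \<C> assume "\<C> \<in> Chains (relation_of (\<supseteq>) A)"
    then have sub: "\<C> \<subseteq> A" and lin: "\<And>C D. C \<in> \<C> \<Longrightarrow> D \<in> \<C> \<Longrightarrow> C \<subseteq> D \<or> D \<subseteq> C"
      by (auto simp: Chains_def relation_of_def)
    show "\<exists>u\<in>A. \<forall>C\<in>\<C>. u \<subseteq> C"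
    proof (cases "\<C> = {}")
      case True
      then show ?thesis using K by (auto simp: A_def)
    next
      case False
      have least: "\<Inter>\<F> \<in> \<F>" if "finite \<F>" "\<F> \<noteq> {}" "\<F> \<subseteq> \<C>" for \<F>
        using that
      proof (induction \<F> rule: finite_ne_induct)
        case (insert C \<F>)
        then have "C \<subseteq> \<Inter>\<F> \<or> \<Inter>\<F> \<subseteq> C" using lin by blast
        with insert show ?case by (auto simp: inf.absorb1 inf.absorb2)
      qed auto
      have "\<Inter>\<C> \<noteq> {}"
      proof (rule compact_space_fip[THEN iffD1, OF X, rule_format, OF conjI])
        show "\<forall>C\<in>\<C>. closedin X C" using sub closed by (auto simp: A_def)
        show "\<forall>\<F>. finite \<F> \<and> \<F> \<subseteq> \<C> \<longrightarrow> \<Inter>\<F> \<noteq> {}"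
        proof clarify
          fix \<F> assume "finite \<F>" "\<F> \<subseteq> \<C>" "\<Inter>\<F> = {}"
          then have "\<Inter>\<F> \<in> \<C>" using least[of \<F>] by (cases "\<F> = {}") auto
          then have "P {}" using sub \<open>\<Inter>\<F> = {}\<close> by (auto simp: A_def)
          then show False using closed by blast
        qed
      qed
      then have "P (\<Inter>\<C>)" using False sub by (intro Inter) (auto simp: A_def)
      moreover have "\<Inter>\<C> \<subseteq> K" using False sub by (auto simp: A_def)
      ultimately show ?thesis by (intro bexI[of _ "\<Inter>\<C>"]) (auto simp: A_def)
    qed
  qed
  then show ?thesis using that by (auto simp: A_def)
qed

text \<open>Ellis: for \<open>p\<close> in a minimal closed subsemigroup \<open>M\<close>, the set \<open>M p\<close> is again a closed subsemigroup,
so \<open>p = q p\<close> for some \<open>q\<close> in \<open>M\<close>. Then \<open>{q \<in> M. q p = p}\<close> is a nonempty closed subsemigroup too,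
hence equals \<open>M\<close> and contains \<open>p\<close>.\<close>

lemma ellis_idempotent:
  assumes Y: "compact_space Y" "Hausdorff_space Y" "topspace Y \<noteq> {}"
    and assoc: "\<And>p q r. p \<in> topspace Y \<Longrightarrow> q \<in> topspace Y \<Longrightarrow> r \<in> topspace Y \<Longrightarrow>
      m (m p q) r = m p (m q r)"
    and cont: "\<And>q. q \<in> topspace Y \<Longrightarrow> continuous_map Y Y (\<lambda>p. m p q)"
  obtains u where "u \<in> topspace Y" "m u u = u"
proof -
  define P where "P M \<longleftrightarrow> closedin Y M \<and> M \<noteq> {} \<and> (\<forall>p\<in>M. \<forall>q\<in>M. m p q \<in> M)" for M
  have mclosed: "m p q \<in> topspace Y" if "p \<in> topspace Y" "q \<in> topspace Y" for p q
    using cont[OF that(2)] that(1) by (auto simp: continuous_map_def)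
  obtain M where M: "P M" and min: "\<And>C. P C \<Longrightarrow> C \<subseteq> M \<Longrightarrow> C = M"
  proof (rule minimal_nonempty_closed_set[OF Y(1), of P "topspace Y"])
    show "P (topspace Y)" using Y(3) mclosed by (auto simp: P_def)
    show "P (\<Inter>\<C>)" if "\<C> \<noteq> {}" "\<And>C. C \<in> \<C> \<Longrightarrow> P C" "\<Inter>\<C> \<noteq> {}" for \<C>
      using that by (auto simp: P_def)
  qed (auto simp: P_def)
  then obtain p where p: "p \<in> M" by (auto simp: P_def)
  have Msub: "M \<subseteq> topspace Y" using M closedin_subset by (auto simp: P_def)
  have "P ((\<lambda>q. m q p) ` M)"
    unfolding P_def
  proof (intro conjI ballI)
    have "compactin Y ((\<lambda>q. m q p) ` M)"
      using M p Msub Y(1) by (intro image_compactin[OF _ cont]) (auto simp: P_def closedin_compact_space)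
    then show "closedin Y ((\<lambda>q. m q p) ` M)" using Y(2) by (rule compactin_imp_closedin[rotated])
    show "(\<lambda>q. m q p) ` M \<noteq> {}" using p by auto
    fix a b assume "a \<in> (\<lambda>q. m q p) ` M" "b \<in> (\<lambda>q. m q p) ` M"
    then obtain a' b' where ab: "a' \<in> M" "b' \<in> M" "a = m a' p" "b = m b' p" by auto
    have "a' \<in> topspace Y" "b' \<in> topspace Y" "p \<in> topspace Y" using ab p Msub by auto
    then have "m a b = m (m (m a' p) b') p"
      unfolding ab by (simp add: assoc mclosed)
    moreover have "m (m a' p) b' \<in> M" using ab p M by (auto simp: P_def)
    ultimately show "m a b \<in> (\<lambda>q. m q p) ` M" by auto
  qed
  moreover have "(\<lambda>q. m q p) ` M \<subseteq> M" using M p by (auto simp: P_def)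
  ultimately have "(\<lambda>q. m q p) ` M = M" by (rule min)
  with p obtain q where q: "q \<in> M" "m q p = p" by (metis imageE)
  have "P {q \<in> M. m q p = p}"
    unfolding P_def
  proof (intro conjI ballI)
    have "closedin Y {q \<in> topspace Y. m q p \<in> {p}}"
      using p Msub Y(2) by (intro closedin_continuous_map_preimage[OF cont])
        (auto simp: closedin_Hausdorff_singleton)
    then have "closedin Y (M \<inter> {q \<in> topspace Y. m q p \<in> {p}})"
      using M by (auto simp: P_def)
    moreover have "M \<inter> {q \<in> topspace Y. m q p \<in> {p}} = {q \<in> M. m q p = p}" using Msub by auto
    ultimately show "closedin Y {q \<in> M. m q p = p}" by simp
    show "{q \<in> M. m q p = p} \<noteq> {}" using q by auto
    fix a b assume ab: "a \<in> {q \<in> M. m q p = p}" "b \<in> {q \<in> M. m q p = p}"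
    then have "m (m a b) p = m a (m b p)" using assoc p Msub by blast
    then show "m a b \<in> {q \<in> M. m q p = p}" using ab M by (auto simp: P_def)
  qed
  then have "{q \<in> M. m q p = p} = M" by (rule min) auto
  with p have "m p p = p" by auto
  with p Msub show ?thesis using that by auto
qed

section \<open>Recurrence of distal maps\<close>

text \<open>The pointwise closure \<open>C\<close> of the iterates \<open>s ^^ n\<close> with \<open>n \<ge> 1\<close> is a compact semigroup under
composition, so it contains an idempotent \<open>u\<close>. Since \<open>u (u x) = u x\<close>, iterates of \<open>s\<close> bring \<open>x\<close> and
\<open>u x\<close> together near \<open>u x\<close>, and distality gives \<open>u x = x\<close>. Thus the identity is a pointwise limit of
iterates with \<open>n \<ge> 1\<close>, which is recurrence for all points simultaneously; pairs are enough here.\<close>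

lemma distal_map_recurrent:
  assumes X: "compact_space X" "Hausdorff_space X" and s: "continuous_map X X s"
    and distal: "\<And>x y z. x \<in> topspace X \<Longrightarrow> y \<in> topspace X \<Longrightarrow> z \<in> topspace X \<Longrightarrow>
       (\<And>U. openin X U \<Longrightarrow> z \<in> U \<Longrightarrow> \<exists>n\<ge>1. (s ^^ n) x \<in> U \<and> (s ^^ n) y \<in> U) \<Longrightarrow> x = y"
    and U: "openin X U" "x \<in> U" and V: "openin X V" "y \<in> V"
  obtains n where "n \<ge> 1" "(s ^^ n) x \<in> U" "(s ^^ n) y \<in> V"
proof -
  define S where "S = topspace X"
  define T where "T = product_topology (\<lambda>_. X) S"
  define G where "G = {restrict (s ^^ n) S |n. n \<ge> 1}"
  define C where "C = T closure_of G"
  have sn: "continuous_map X X (s ^^ n)" for n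
    by (induction n) (simp_all add: continuous_map_compose[OF _ s, unfolded o_def] id_def o_def)
  have sS: "(s ^^ n) a \<in> S" if "a \<in> S" for n a
    using sn[of n] that by (auto simp: continuous_map_def S_def)
  have topT: "topspace T = S \<rightarrow>\<^sub>E S" by (simp add: T_def S_def)
  have GT: "G \<subseteq> topspace T" using sS by (auto simp: G_def topT)
  then have GC: "G \<subseteq> C" unfolding C_def by (rule closure_of_subset)
  have CT: "C \<subseteq> topspace T" unfolding C_def by (rule closure_of_subset_topspace)
  \<comment> \<open>Composition is continuous in its left factor for every right factor, but in its right factor
    only when the left one is continuous on the space; the iterates are.\<close>
  have right: "continuous_map T T (\<lambda>p. compose S p q)" if "q \<in> topspace T" for q
  proof -
    have "continuous_map T X (\<lambda>p. compose S p q a)" if "a \<in> S" for a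
    proof -
      have "q a \<in> S" using that \<open>q \<in> topspace T\<close> by (auto simp: topT)
      then have "continuous_map T X (\<lambda>p. p (q a))"
        unfolding T_def by (rule continuous_map_product_projection)
      then show ?thesis using that by (simp add: compose_def)
    qed
    then show ?thesis
      by (subst (2) T_def) (auto simp: continuous_map_componentwise compose_def)
  qed
  have left: "continuous_map T T (\<lambda>p. compose S (restrict (s ^^ n) S) p)" for n
  proof -
    have "continuous_map T X (\<lambda>p. compose S (restrict (s ^^ n) S) p a)" if "a \<in> S" for a
    proof (rule continuous_map_eq)
      show "continuous_map T X ((s ^^ n) \<circ> (\<lambda>p. p a))"
        using sn continuous_map_product_projection[OF that, of "\<lambda>_. X"]
        unfolding T_def by (intro continuous_map_compose)
      show "((s ^^ n) \<circ> (\<lambda>p. p a)) p = compose S (restrict (s ^^ n) S) p a" if "p \<in> topspace T" for p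
        using that \<open>a \<in> S\<close> by (auto simp: compose_def topT)
    qed
    then show ?thesis
      by (subst (2) T_def) (auto simp: continuous_map_componentwise compose_def)
  qed
  have GG: "compose S p q \<in> G" if pq: "p \<in> G" "q \<in> G" for p q
  proof -
    obtain i j where ij: "p = restrict (s ^^ i) S" "q = restrict (s ^^ j) S" "i \<ge> 1" "j \<ge> 1"
      using pq by (auto simp: G_def)
    then have "compose S p q = restrict (s ^^ (i + j)) S"
      using sS by (auto simp: compose_def funpow_add fun_eq_iff)
    then show ?thesis using ij by (auto simp: G_def intro!: exI[of _ "i + j"])
  qed
  have GC': "compose S p q \<in> C" if "p \<in> G" "q \<in> C" for p q
  proof -
    obtain n where n: "p = restrict (s ^^ n) S" using \<open>p \<in> G\<close> by (auto simp: G_def)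
    have "(\<lambda>q. compose S p q) ` C \<subseteq> T closure_of ((\<lambda>q. compose S p q) ` G)"
      unfolding C_def n by (rule continuous_map_image_closure_subset[OF left])
    also have "\<dots> \<subseteq> C" unfolding C_def using GG \<open>p \<in> G\<close> by (intro closure_of_mono) auto
    finally show ?thesis using that by auto
  qed
  have CC: "compose S p q \<in> C" if "p \<in> C" "q \<in> C" for p q
  proof -
    have "(\<lambda>p. compose S p q) ` C \<subseteq> T closure_of ((\<lambda>p. compose S p q) ` G)"
      unfolding C_def using that CT by (intro continuous_map_image_closure_subset[OF right]) auto
    also have "\<dots> \<subseteq> C" using GC' that
      by (intro closure_of_minimal) (auto simp: C_def)
    finally show ?thesis using that by auto
  qed
  obtain u where u: "u \<in> C" "compose S u u = u"
  proof (rule ellis_idempotent[of "subtopology T C" "compose S"])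
    have topC: "topspace (subtopology T C) = C" using CT by auto
    have "compact_space T" using X(1) by (simp add: T_def compact_space_product_topology)
    then show "compact_space (subtopology T C)"
      by (intro closedin_compact_space compact_space_subtopology) (auto simp: C_def)
    show "Hausdorff_space (subtopology T C)"
      using X(2) by (intro Hausdorff_space_subtopology) (simp add: T_def Hausdorff_space_product_topology)
    show "topspace (subtopology T C) \<noteq> {}" using GC topC by (auto simp: G_def)
    show "compose S (compose S p q) r = compose S p (compose S q r)"
      if "p \<in> topspace (subtopology T C)" "q \<in> topspace (subtopology T C)" "r \<in> topspace (subtopology T C)" for p q r
      using that CT unfolding topC topT by (intro compose_assoc[symmetric]) auto
    show "continuous_map (subtopology T C) (subtopology T C) (\<lambda>p. compose S p q)"
      if "q \<in> topspace (subtopology T C)" for q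
      using that CT CC right topC
      by (auto simp: continuous_map_in_subtopology intro!: continuous_map_from_subtopology)
    show thesis if "u \<in> topspace (subtopology T C)" "compose S u u = u" for u
      using that topC by (auto intro!: \<open>\<And>u. u \<in> C \<Longrightarrow> compose S u u = u \<Longrightarrow> thesis\<close>)
  qed
  \<comment> \<open>Membership of \<open>u\<close> in the closure, tested on two coordinates.\<close>
  have approx: "\<exists>n\<ge>1. (s ^^ n) a \<in> W1 \<and> (s ^^ n) b \<in> W2"
    if "a \<in> S" "b \<in> S" "openin X W1" "u a \<in> W1" "openin X W2" "u b \<in> W2" for a b W1 W2
  proof -
    have ev: "continuous_map T X (\<lambda>p. p c)" if "c \<in> S" for c
      using that unfolding T_def by (intro continuous_map_product_projection)
    define N where "N = {p \<in> topspace T. p a \<in> W1} \<inter> {p \<in> topspace T. p b \<in> W2}"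
    have "openin T N" unfolding N_def
      using that ev by (intro openin_Int openin_continuous_map_preimage)
    moreover have "u \<in> N" using u CT that by (auto simp: N_def)
    moreover have "u \<in> T closure_of G" using u(1) by (simp add: C_def)
    ultimately obtain g where "g \<in> G" "g \<in> N" unfolding in_closure_of by metis
    then have "g a \<in> W1" "g b \<in> W2" by (auto simp: N_def)
    with \<open>g \<in> G\<close> show ?thesis using that by (auto simp: G_def)
  qed
  have uS: "u a \<in> S" if "a \<in> S" for a using u CT topT that by auto
  have uid: "u a = a" if "a \<in> S" for a
  proof (rule sym, rule distal[of a "u a" "u a"])
    have "u (u a) = u a" using u(2) that by (metis compose_eq)
    then show "\<exists>n\<ge>1. (s ^^ n) a \<in> W \<and> (s ^^ n) (u a) \<in> W" if "openin X W" "u a \<in> W" for W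
      using approx[of a "u a" W W] that \<open>a \<in> S\<close> uS by auto
  qed (use that uS S_def in auto)
  have "x \<in> S" "y \<in> S" using U V openin_subset by (auto simp: S_def)
  then show ?thesis using approx[of x y U V] uid U V that by auto
qed

section \<open>The Hahn-Banach theorem\<close>

definition sublinear :: "('a::real_vector \<Rightarrow> real) \<Rightarrow> bool" where
  "sublinear p \<longleftrightarrow> (\<forall>x y. p (x + y) \<le> p x + p y) \<and> (\<forall>c\<ge>0. \<forall>x. p (c *\<^sub>R x) = c * p x)"

lemma sublinear_add: "sublinear p \<Longrightarrow> p (x + y) \<le> p x + p y"
  and sublinear_scale: "sublinear p \<Longrightarrow> c \<ge> 0 \<Longrightarrow> p (c *\<^sub>R x) = c * p x"
  by (auto simp: sublinear_def)

lemma sublinear_zero: "sublinear p \<Longrightarrow> p 0 = 0"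
  using sublinear_scale[of p 0 0] by simp

lemma sublinear_ge_minus: "sublinear p \<Longrightarrow> - p (- x) \<le> p x"
  using sublinear_add[of p x "- x"] sublinear_zero[of p] by simp

text \<open>Only one inequality is needed for homogeneity, since the other one is its instance for \<open>1 / c\<close>.\<close>

lemma sublinearI:
  assumes add: "\<And>x y. p (x + y) \<le> p x + p y" and zero: "p 0 = 0"
    and scale: "\<And>c x. c > 0 \<Longrightarrow> p (c *\<^sub>R x) \<le> c * p x"
  shows "sublinear p"
proof -
  have "p (c *\<^sub>R x) = c * p x" if "c \<ge> 0" for c x
  proof (cases "c = 0")
    case False
    with that have c: "c > 0" by simp
    then have "p x \<le> (1 / c) * p (c *\<^sub>R x)" using scale[of "1 / c" "c *\<^sub>R x"] by simp
    with scale[OF c, of x] c show ?thesis by (simp add: field_simps)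
  qed (simp add: zero)
  with add show ?thesis by (simp add: sublinear_def)
qed

text \<open>The functional \<open>r\<close> is the largest sublinear one below \<open>q\<close> with \<open>r (- y) \<le> - q y\<close>. It serves twice:
it shows that minimal sublinear functionals are odd, and it forces the functional of the
Hahn-Banach theorem to attain the value \<open>p x0\<close> at \<open>x0\<close>.\<close>

lemma sublinear_descent:
  fixes q :: "'a::real_vector \<Rightarrow> real" and y :: 'a
  assumes q: "sublinear q"
  obtains r where "sublinear r" "\<And>x. r x \<le> q x" "r (- y) \<le> - q y"
proof
  define r where "r x = (INF t\<in>{0..}. q (x + t *\<^sub>R y) - t * q y)" for x
  have lower: "- q (- x) \<le> q (x + t *\<^sub>R y) - t * q y" if "t \<ge> 0" for x t
    using sublinear_add[OF q, of "x + t *\<^sub>R y" "- x"] sublinear_scale[OF q that, of y] by simp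
  have bdd: "bdd_below ((\<lambda>t. q (x + t *\<^sub>R y) - t * q y) ` {0..})" for x
    using lower by (intro bdd_belowI2[of _ "- q (- x)"]) auto
  have le: "r x \<le> q (x + t *\<^sub>R y) - t * q y" if "t \<ge> 0" for x t
    unfolding r_def using that by (intro cINF_lower bdd) auto
  have ge: "c \<le> r x" if "\<And>t. t \<ge> 0 \<Longrightarrow> c \<le> q (x + t *\<^sub>R y) - t * q y" for c x
    unfolding r_def using that by (intro cINF_greatest) auto
  show "r x \<le> q x" for x using le[of 0 x] by simp
  show "r (- y) \<le> - q y" using le[of 1 "- y"] sublinear_zero[OF q] by simp
  have "r (a + b) \<le> r a + r b" for a b
  proof -
    have "r (a + b) - (q (b + t *\<^sub>R y) - t * q y) \<le> r a" if t: "t \<ge> 0" for t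
    proof (rule ge)
      fix u :: real assume u: "u \<ge> 0"
      have "r (a + b) \<le> q ((a + b) + (u + t) *\<^sub>R y) - (u + t) * q y" using t u by (intro le) simp
      also have "(a + b) + (u + t) *\<^sub>R y = (a + u *\<^sub>R y) + (b + t *\<^sub>R y)" by (simp add: algebra_simps)
      also have "q \<dots> \<le> q (a + u *\<^sub>R y) + q (b + t *\<^sub>R y)" by (rule sublinear_add[OF q])
      finally show "r (a + b) - (q (b + t *\<^sub>R y) - t * q y) \<le> q (a + u *\<^sub>R y) - u * q y"
        by (simp add: algebra_simps)
    qed
    then have "r (a + b) - r a \<le> r b" by (intro ge) (simp add: algebra_simps)
    then show ?thesis by simp
  qed
  moreover have "r 0 = 0"
  proof (rule antisym)
    show "r 0 \<le> 0" using le[of 0 0] sublinear_zero[OF q] by simp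
    show "0 \<le> r 0" using sublinear_scale[OF q] by (intro ge) simp
  qed
  moreover have "r (c *\<^sub>R a) \<le> c * r a" if c: "c > 0" for c a
  proof -
      have "r (c *\<^sub>R a) / c \<le> r a"
      proof (rule ge)
        fix t :: real assume t: "t \<ge> 0"
        have "r (c *\<^sub>R a) \<le> q (c *\<^sub>R a + (c * t) *\<^sub>R y) - (c * t) * q y" using c t by (intro le) simp
        also have "c *\<^sub>R a + (c * t) *\<^sub>R y = c *\<^sub>R (a + t *\<^sub>R y)" by (simp add: algebra_simps)
        also have "q \<dots> = c * q (a + t *\<^sub>R y)" using c by (intro sublinear_scale[OF q]) simp
        finally show "r (c *\<^sub>R a) / c \<le> q (a + t *\<^sub>R y) - t * q y"
          using c by (simp add: field_simps)
      qed
      then show ?thesis using c by (simp add: field_simps)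
  qed
  ultimately show "sublinear r" by (rule sublinearI)
qed

lemma minimal_sublinear_linear:
  fixes q :: "'a::real_vector \<Rightarrow> real"
  assumes q: "sublinear q" and min: "\<And>r. sublinear r \<Longrightarrow> r \<le> q \<Longrightarrow> r = q"
  shows "linear q"
proof (rule linearI)
  have minus: "q (- y) = - q y" for y
  proof -
    obtain r where r: "sublinear r" "\<And>x. r x \<le> q x" "r (- y) \<le> - q y"
      using sublinear_descent[OF q, of y] by blast
    then have "r = q" by (intro min) (auto simp: le_fun_def)
    with r have "q (- y) \<le> - q y" by simp
    with sublinear_ge_minus[OF q, of "- y"] show ?thesis by simp
  qed
  show "q (x + y) = q x + q y" for x y
    using sublinear_add[OF q, of x y] sublinear_add[OF q, of "- x" "- y"]
      minus[of x] minus[of y] minus[of "x + y"] by simp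
  show "q (c *\<^sub>R x) = c *\<^sub>R q x" for c x
    using sublinear_scale[OF q, of c x] sublinear_scale[OF q, of "- c" x] minus[of "c *\<^sub>R x"]
    by (cases "c \<ge> 0") auto
qed

text \<open>A minimal sublinear functional below \<open>p\<close> exists by Zorn's lemma: the pointwise infimum of a chain
is finite because of the bound \<open>- p (- x)\<close>, and subadditive because two members of the chain can
be replaced by the smaller one.\<close>

lemma exists_linear_below_sublinear:
  fixes p :: "'a::real_vector \<Rightarrow> real"
  assumes p: "sublinear p"
  obtains f where "linear f" "f \<le> p"
proof -
  define A where "A = {q. sublinear q \<and> q \<le> p}"
  have "\<exists>m\<in>A. \<forall>q\<in>A. m \<ge> q \<longrightarrow> q = m"
  proof (rule predicate_Zorn)
    show "partial_order_on A (relation_of (\<ge>) A)"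
      by (rule partial_order_on_relation_ofI) auto
    fix C assume C: "C \<in> Chains (relation_of (\<ge>) A)"
    then have sub: "C \<subseteq> A" and lin: "\<And>a b. a \<in> C \<Longrightarrow> b \<in> C \<Longrightarrow> a \<le> b \<or> b \<le> a"
      by (auto simp: Chains_def relation_of_def)
    show "\<exists>u\<in>A. \<forall>a\<in>C. u \<le> a"
    proof (cases "C = {}")
      case True
      then show ?thesis using p by (auto simp: A_def)
    next
      case False
      define u where "u x = (INF q\<in>C. q x)" for x
      have lower: "- p (- x) \<le> q x" if "q \<in> C" for q x
      proof -
        have "sublinear q" "q (- x) \<le> p (- x)" using that sub by (auto simp: A_def le_fun_def)
        then show ?thesis using sublinear_ge_minus[of q x] by simp
      qed
      have le: "u x \<le> q x" if "q \<in> C" for q x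
        unfolding u_def using that lower by (intro cINF_lower bdd_belowI2[of _ "- p (- x)"]) auto
      have ge: "c \<le> u x" if "\<And>q. q \<in> C \<Longrightarrow> c \<le> q x" for c x
        unfolding u_def using that False by (intro cINF_greatest) auto
      have subl: "sublinear q" if "q \<in> C" for q using that sub by (auto simp: A_def)
      have "u (x + y) \<le> u x + u y" for x y
      proof -
        have "u (x + y) - q y \<le> u x" if "q \<in> C" for q
        proof (rule ge)
          fix q' assume "q' \<in> C"
          with that obtain m where m: "m \<in> C" "m \<le> q" "m \<le> q'" using lin by blast
          have "u (x + y) \<le> m x + m y" using le[OF m(1), of "x + y"] sublinear_add[OF subl[OF m(1)], of x y] by simp
          also have "\<dots> \<le> q' x + q y" using m by (auto simp: le_fun_def intro: add_mono)
          finally show "u (x + y) - q y \<le> q' x" by simp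
        qed
        then have "u (x + y) - u x \<le> u y" by (intro ge) (simp add: algebra_simps)
        then show ?thesis by simp
      qed
      moreover have "u 0 = 0"
        using False subl by (simp add: u_def sublinear_zero)
      moreover have "u (c *\<^sub>R x) \<le> c * u x" if c: "c > 0" for c x
      proof -
        have "u (c *\<^sub>R x) / c \<le> u x"
        proof (rule ge)
          fix q assume "q \<in> C"
          with le[of q "c *\<^sub>R x"] show "u (c *\<^sub>R x) / c \<le> q x"
            using c by (simp add: sublinear_scale subl field_simps)
        qed
        then show ?thesis using c by (simp add: field_simps)
      qed
      ultimately have "sublinear u" by (rule sublinearI)
      moreover have "u x \<le> p x" for x
      proof -
        obtain q where "q \<in> C" using False by auto
        then show ?thesis using le[of q x] sub by (auto simp: A_def le_fun_def intro: order_trans)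
      qed
      ultimately show ?thesis using le by (auto simp: A_def le_fun_def intro!: bexI[of _ u])
    qed
  qed
  then obtain m where m: "m \<in> A" "\<And>q. q \<in> A \<Longrightarrow> q \<le> m \<Longrightarrow> q = m" by auto
  then have "linear m" by (intro minimal_sublinear_linear) (auto simp: A_def)
  with m that show ?thesis by (auto simp: A_def)
qed

text \<open>Used with \<open>p = norm\<close> to obtain norming functionals, and with \<open>p\<close> the distance to a subspace to
separate points from it.\<close>

lemma hahn_banach_support:
  fixes p :: "'a::real_normed_vector \<Rightarrow> real"
  assumes p: "sublinear p" and bound: "\<And>x. p x \<le> norm x"
  obtains f :: "'a \<Rightarrow>\<^sub>L real" where "\<And>x. blinfun_apply f x \<le> p x" "blinfun_apply f x0 = p x0"
    "norm f \<le> 1"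
proof -
  obtain r where r: "sublinear r" "\<And>x. r x \<le> p x" "r (- x0) \<le> - p x0"
    using sublinear_descent[OF p, of x0] by blast
  obtain g where g: "linear g" "\<And>x. g x \<le> r x"
    using exists_linear_below_sublinear[OF r(1)] by (auto simp: le_fun_def)
  have gp: "g x \<le> p x" for x
    using g(2)[of x] r(2)[of x] by simp
  have "g (- x0) \<le> - p x0"
    using g(2)[of "- x0"] r(3) by simp
  then have gx0: "g x0 = p x0" using gp[of x0] linear_neg[OF g(1), of x0] by simp
  have abs: "\<bar>g x\<bar> \<le> norm x" for x
    using gp[of x] gp[of "- x"] bound[of x] bound[of "- x"] linear_neg[OF g(1), of x] by simp
  have bl: "bounded_linear g"
    using linear_add[OF g(1)] linear_scale[OF g(1)] abs
    by (intro bounded_linear_intro[where K = 1]) auto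
  show ?thesis
  proof (rule that[of "Blinfun g"])
    show "norm (Blinfun g) \<le> 1"
      using abs by (intro norm_blinfun_bound) (auto simp: bounded_linear_Blinfun_apply[OF bl])
  qed (use gp gx0 in \<open>auto simp: bounded_linear_Blinfun_apply[OF bl]\<close>)
qed

section \<open>The weak topology\<close>

lemma compactin_pullback_topology:
  assumes "compactin T (f ` E)"
  shows "compactin (pullback_topology UNIV f T) E"
  unfolding compactin_def
proof (intro conjI allI impI)
  show "E \<subseteq> topspace (pullback_topology UNIV f T)"
    using assms by (auto simp: topspace_pullback_topology compactin_def)
  fix \<U> assume U: "Ball \<U> (openin (pullback_topology UNIV f T)) \<and> E \<subseteq> \<Union>\<U>"
  then obtain g where g: "\<And>V. V \<in> \<U> \<Longrightarrow> openin T (g V) \<and> V = f -` g V"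
    unfolding openin_pullback_topology by (metis Int_UNIV_right)
  have "f ` E \<subseteq> \<Union>(g ` \<U>)"
  proof clarify
    fix x assume "x \<in> E"
    then obtain V where V: "V \<in> \<U>" "x \<in> V" using U by auto
    then have "f x \<in> g V" using g[OF V(1)] by auto
    then show "f x \<in> \<Union>(g ` \<U>)" using V(1) by auto
  qed
  moreover have "\<And>W. W \<in> g ` \<U> \<Longrightarrow> openin T W" using g by auto
  ultimately have "\<exists>\<F>. finite \<F> \<and> \<F> \<subseteq> g ` \<U> \<and> f ` E \<subseteq> \<Union>\<F>"
    using compactinD[OF assms] by metis
  then obtain \<F> where F: "finite \<F>" "\<F> \<subseteq> g ` \<U>" "f ` E \<subseteq> \<Union>\<F>" by auto
  then obtain \<F>' where F': "\<F>' \<subseteq> \<U>" "finite \<F>'" "\<F> = g ` \<F>'"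
    by (meson finite_subset_image)
  have "E \<subseteq> \<Union>\<F>'"
  proof
    fix x assume "x \<in> E"
    then obtain V where V: "V \<in> \<F>'" "f x \<in> g V" using F F' by auto
    then have "x \<in> V" using g F'(1) by (metis subsetD vimageI)
    then show "x \<in> \<Union>\<F>'" using V by auto
  qed
  then show "\<exists>\<F>. finite \<F> \<and> \<F> \<subseteq> \<U> \<and> E \<subseteq> \<Union>\<F>" using F' by blast
qed

lemma continuous_map_weak_blinfun:
  "continuous_map weak_topology euclideanreal (blinfun_apply f)"
proof -
  have "continuous_map weak_topology euclideanreal ((\<lambda>\<phi>. \<phi> f) \<circ> (\<lambda>x f. blinfun_apply f x))"
    unfolding weak_topology_def
    by (rule continuous_map_pullback) (use continuous_on_product_coordinates in fastforce)
  then show ?thesis by (simp add: comp_def)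
qed

lemma openin_weak_greater:
  fixes f :: "'a::real_normed_vector \<Rightarrow>\<^sub>L real"
  shows "openin weak_topology {x. c < blinfun_apply f x}"
  using openin_continuous_map_preimage[OF continuous_map_weak_blinfun, of "{c<..}" f] by simp

lemma openin_weak_less:
  fixes f :: "'a::real_normed_vector \<Rightarrow>\<^sub>L real"
  shows "openin weak_topology {x. blinfun_apply f x < c}"
  using openin_continuous_map_preimage[OF continuous_map_weak_blinfun, of "{..<c}" f] by simp

lemma closedin_weak_atMost:
  fixes f :: "'a::real_normed_vector \<Rightarrow>\<^sub>L real"
  shows "closedin weak_topology {x. blinfun_apply f x \<le> c}"
  using closedin_continuous_map_preimage[OF continuous_map_weak_blinfun, of "{..c}" f] by simp

lemma sublinear_norm: "sublinear (norm :: 'a::real_normed_vector \<Rightarrow> real)"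
  by (rule sublinearI) (auto intro: norm_triangle_ineq)

lemma norming_functional:
  fixes x :: "'a::real_normed_vector"
  obtains f :: "'a \<Rightarrow>\<^sub>L real" where "blinfun_apply f x = norm x" "norm f \<le> 1"
  using hahn_banach_support[OF sublinear_norm, of x] by auto

lemma blinfun_le_norm:
  assumes "norm (f :: 'a::real_normed_vector \<Rightarrow>\<^sub>L real) \<le> 1"
  shows "blinfun_apply f x \<le> norm x"
  using norm_blinfun[of f x] assms mult_right_mono[of "norm f" 1 "norm x"] by simp

lemma Hausdorff_weak_topology: "Hausdorff_space weak_topology"
  unfolding Hausdorff_space_def
proof (intro allI impI)
  fix x y :: 'a assume "x \<in> topspace weak_topology \<and> y \<in> topspace weak_topology \<and> x \<noteq> y"
  obtain f where f: "blinfun_apply f (x - y) = norm (x - y)" by (rule norming_functional)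
  define c where "c = (blinfun_apply f x + blinfun_apply f y) / 2"
  have "norm (x - y) > 0" using \<open>_ \<and> _ \<and> x \<noteq> y\<close> by simp
  then have "blinfun_apply f y < c" "c < blinfun_apply f x"
    unfolding f[symmetric] by (simp_all add: blinfun.diff_right c_def)
  then show "\<exists>U V. openin weak_topology U \<and> openin weak_topology V \<and> x \<in> U \<and> y \<in> V \<and> disjnt U V"
    by (intro exI[of _ "{z. c < blinfun_apply f z}"] exI[of _ "{z. blinfun_apply f z < c}"])
      (auto simp: openin_weak_greater openin_weak_less disjnt_iff)
qed

text \<open>By norming functionals a ball is an intersection of closed half spaces; equivalently, the norm is
weakly lower semicontinuous.\<close>

lemma closedin_weak_cball: "closedin weak_topology (cball (a :: 'a::real_normed_vector) r)"
proof -
  have "cball a r = (\<Inter>f\<in>{f. norm f \<le> 1}. {x. blinfun_apply f x \<le> blinfun_apply f a + r})"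
  proof (intro set_eqI iffI)
    fix x assume "x \<in> cball a r"
    then have "norm (x - a) \<le> r" by (simp add: dist_norm norm_minus_commute)
    then have "blinfun_apply f (x - a) \<le> r" if "norm f \<le> 1" for f
      using blinfun_le_norm[OF that, of "x - a"] by simp
    then show "x \<in> (\<Inter>f\<in>{f. norm f \<le> 1}. {x. blinfun_apply f x \<le> blinfun_apply f a + r})"
      by (auto simp: blinfun.diff_right algebra_simps)
  next
    fix x assume x: "x \<in> (\<Inter>f\<in>{f. norm f \<le> 1}. {x. blinfun_apply f x \<le> blinfun_apply f a + r})"
    obtain f where f: "blinfun_apply f (x - a) = norm (x - a)" "norm f \<le> 1"
      by (rule norming_functional)
    then show "x \<in> cball a r"
      using x by (auto simp: blinfun.diff_right dist_norm norm_minus_commute)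
  qed
  also have "closedin weak_topology \<dots>"
    by (rule closedin_Inter) (auto simp: closedin_weak_atMost intro: exI[of _ 0])
  finally show ?thesis .
qed

text \<open>The distance \<open>p\<close> to \<open>V\<close> is sublinear. A linear functional below \<open>p\<close> that agrees with \<open>p\<close> at a
point outside \<open>V\<close> is positive there and nonpositive on \<open>V\<close>.\<close>

lemma closedin_weak_closed_subspace:
  fixes V :: "'a::real_normed_vector set"
  assumes V: "subspace V" "closed V"
  shows "closedin weak_topology V"
proof -
  define p where "p x = infdist x V" for x
  have ne: "V \<noteq> {}" using V(1) subspace_0 by blast
  have near: "\<exists>v\<in>V. norm (x - v) < p x + e" if "e > 0" for x e
  proof (rule ccontr)
    assume "\<not> ?thesis"
    then have "p x + e \<le> p x"
      using ne unfolding p_def infdist_notempty[OF ne]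
      by (intro cINF_greatest) (auto simp: dist_norm not_less)
    with that show False by simp
  qed
  have le: "p x \<le> norm (x - v)" if "v \<in> V" for x v
    using infdist_le[OF that, of x] by (simp add: p_def dist_norm)
  have "sublinear p"
  proof (rule sublinearI)
    show "p 0 = 0" using subspace_0[OF V(1)] by (simp add: p_def)
    show "p (x + y) \<le> p x + p y" for x y
    proof (rule field_le_epsilon)
      fix e :: real assume "e > 0"
      then obtain v w where vw: "v \<in> V" "w \<in> V" "norm (x - v) < p x + e / 2" "norm (y - w) < p y + e / 2"
        using near by (meson half_gt_zero)
      have "p (x + y) \<le> norm ((x - v) + (y - w))"
        using le[OF subspace_add[OF V(1) vw(1,2)], of "x + y"] by (simp add: algebra_simps)
      also have "\<dots> \<le> norm (x - v) + norm (y - w)" by (rule norm_triangle_ineq)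
      finally show "p (x + y) \<le> p x + p y + e" using vw by simp
    qed
    show "p (c *\<^sub>R x) \<le> c * p x" if c: "c > 0" for c x
    proof (rule field_le_epsilon)
      fix e :: real assume "e > 0"
      then obtain v where v: "v \<in> V" "norm (x - v) < p x + e / c" using near[of "e / c"] c by auto
      have "p (c *\<^sub>R x) \<le> norm (c *\<^sub>R (x - v))"
        using le[OF subspace_scale[OF V(1) v(1)], of "c *\<^sub>R x" c] by (simp add: algebra_simps)
      also have "\<dots> = c * norm (x - v)" using c by simp
      also have "\<dots> \<le> c * p x + e" using v c by (simp add: field_simps)
      finally show "p (c *\<^sub>R x) \<le> c * p x + e" .
    qed
  qed
  moreover have "p x \<le> norm x" for x using le[OF subspace_0[OF V(1)], of x] by simp
  ultimately have sup: "\<exists>f::'a \<Rightarrow>\<^sub>L real. (\<forall>x. blinfun_apply f x \<le> p x) \<and> blinfun_apply f x0 = p x0" for x0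
    by (metis hahn_banach_support)
  have "\<exists>T. openin weak_topology T \<and> x \<in> T \<and> T \<subseteq> UNIV - V" if "x \<notin> V" for x
  proof -
    obtain f :: "'a \<Rightarrow>\<^sub>L real" where f: "\<And>x. blinfun_apply f x \<le> p x" "blinfun_apply f x = p x"
      using sup by blast
    have "p x > 0" using that V(2) ne in_closed_iff_infdist_zero[of V x] infdist_nonneg[of x V]
      by (simp add: p_def)
    moreover have "blinfun_apply f v \<le> 0" if "v \<in> V" for v using f(1)[of v] that by (simp add: p_def)
    ultimately show ?thesis using f(2)
      by (intro exI[of _ "{z. 0 < blinfun_apply f z}"]) (auto simp: openin_weak_greater not_less[symmetric])
  qed
  then have "openin weak_topology (UNIV - V)" by (subst openin_subopen) auto
  then show ?thesis by (simp add: closedin_def)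
qed

section \<open>Weak* compactness\<close>

text \<open>The ball is, inside the product of the intervals \<open>{- (M * norm f)..M * norm f}\<close>, the set of linear
functions, which is closed for pointwise convergence; Tychonoff's theorem applies.\<close>

lemma banach_alaoglu:
  "compactin strong_operator_topology {\<phi> :: 'b::real_normed_vector \<Rightarrow>\<^sub>L real. norm \<phi> \<le> M}"
proof (cases "M \<ge> 0")
  case M: True
  define K where "K = Pi\<^sub>E (UNIV :: 'b set) (\<lambda>f. {- (M * norm f)..M * norm f})"
  define L where "L = {g :: 'b \<Rightarrow> real. (\<forall>x y. g (x + y) = g x + g y) \<and> (\<forall>c x. g (c *\<^sub>R x) = c * g x)}"
  have "compactin (product_topology (\<lambda>_. euclideanreal) (UNIV :: 'b set)) K"
    unfolding K_def by (subst compactin_PiE) auto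
  then have "compact K" by (simp add: euclidean_product_topology)
  moreover have "closed L"
    unfolding L_def
    by (intro closed_Collect_conj closed_Collect_all closed_Collect_eq continuous_intros continuous_on_product_coordinates)
  ultimately have "compact (K \<inter> L)" by (rule compact_Int_closed)
  moreover have "K \<inter> L = blinfun_apply ` {\<phi>. norm \<phi> \<le> M}"
  proof (intro set_eqI iffI)
    fix g assume g: "g \<in> K \<inter> L"
    then have bd: "\<bar>g x\<bar> \<le> M * norm x" for x by (auto simp: K_def PiE_iff abs_le_iff minus_le_iff)
    have bl: "bounded_linear g"
      using g bd by (intro bounded_linear_intro[where K = M]) (auto simp: L_def mult.commute)
    have "norm (Blinfun g) \<le> M"
      using bd M by (intro norm_blinfun_bound) (auto simp: bounded_linear_Blinfun_apply[OF bl])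
    then show "g \<in> blinfun_apply ` {\<phi>. norm \<phi> \<le> M}"
      by (intro image_eqI[of _ _ "Blinfun g"]) (auto simp: bounded_linear_Blinfun_apply[OF bl])
  next
    fix g assume "g \<in> blinfun_apply ` {\<phi> :: 'b \<Rightarrow>\<^sub>L real. norm \<phi> \<le> M}"
    then obtain \<phi> :: "'b \<Rightarrow>\<^sub>L real" where \<phi>: "g = blinfun_apply \<phi>" "norm \<phi> \<le> M" by auto
    have "\<bar>g x\<bar> \<le> M * norm x" for x
      using norm_blinfun[of \<phi> x] \<phi> mult_right_mono[OF \<phi>(2), of "norm x"] by simp
    then show "g \<in> K \<inter> L"
      by (auto simp: K_def L_def \<phi>(1) blinfun.add_right blinfun.scaleR_right abs_le_iff minus_le_iff)
  qed
  ultimately show ?thesis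
    unfolding strong_operator_topology_def by (intro compactin_pullback_topology) simp
next
  case False
  then have "{\<phi> :: 'b \<Rightarrow>\<^sub>L real. norm \<phi> \<le> M} = {}" by (auto dest: order_trans[OF norm_ge_zero])
  then show ?thesis by simp
qed

lemma closedin_strong_operator_cball:
  fixes \<psi> :: "'b::real_normed_vector \<Rightarrow>\<^sub>L real"
  assumes "r \<ge> 0"
  shows "closedin strong_operator_topology {\<phi>. norm (\<phi> - \<psi>) \<le> r}"
proof -
  have "{\<phi>. norm (\<phi> - \<psi>) \<le> r} = (\<Inter>f. {\<phi>. blinfun_apply \<phi> f \<in> cball (blinfun_apply \<psi> f) (r * norm f)})"
  proof (intro set_eqI iffI)
    fix \<phi> assume "\<phi> \<in> {\<phi>. norm (\<phi> - \<psi>) \<le> r}"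
    then have "norm (blinfun_apply (\<phi> - \<psi>) f) \<le> r * norm f" for f
      using norm_blinfun[of "\<phi> - \<psi>" f] mult_right_mono[of "norm (\<phi> - \<psi>)" r "norm f"] by simp
    then show "\<phi> \<in> (\<Inter>f. {\<phi>. blinfun_apply \<phi> f \<in> cball (blinfun_apply \<psi> f) (r * norm f)})"
      by (simp add: blinfun.diff_left dist_norm abs_minus_commute)
  next
    fix \<phi> assume "\<phi> \<in> (\<Inter>f. {\<phi>. blinfun_apply \<phi> f \<in> cball (blinfun_apply \<psi> f) (r * norm f)})"
    then have "norm (blinfun_apply (\<phi> - \<psi>) f) \<le> r * norm f" for f
      by (simp add: blinfun.diff_left dist_norm abs_minus_commute)
    then show "\<phi> \<in> {\<phi>. norm (\<phi> - \<psi>) \<le> r}" using assms by (auto intro: norm_blinfun_bound)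
  qed
  moreover have "closedin strong_operator_topology {\<phi> :: 'b \<Rightarrow>\<^sub>L real. blinfun_apply \<phi> f \<in> C}"
    if "closed C" for C f
    using closedin_continuous_map_preimage[OF strong_operator_topology_continuous_evaluation[of f], of C] that
    by (simp add: strong_operator_topology_topspace)
  then have "closedin strong_operator_topology
      (\<Inter>f. {\<phi>. blinfun_apply \<phi> f \<in> cball (blinfun_apply \<psi> f) (r * norm f)})"
    by (intro closedin_Inter) (auto simp del: mem_cball)
  ultimately show ?thesis by simp
qed

lemma pullback_pullback_topology:
  "pullback_topology UNIV g (pullback_topology UNIV f T) = pullback_topology UNIV (f \<circ> g) T"
  unfolding topology_eq openin_pullback_topology by (auto simp: vimage_comp)

text \<open>Weak compactness of a set in the space can therefore be checked in the bidual.\<close>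

lemma weak_topology_pullback_bidual:
  "weak_topology = pullback_topology UNIV bidual_embedding bidual_weak_star"
proof -
  have *: "(\<lambda>x f. blinfun_apply f x) = blinfun_apply \<circ> bidual_embedding"
    by (intro ext) (simp add: bidual_embedding.rep_eq)
  then show ?thesis
    by (simp only: weak_topology_def strong_operator_topology_def pullback_pullback_topology *)
qed

section \<open>Chebyshev centers in L-embedded sets\<close>

lemma bidual_embedding_diff: "bidual_embedding (x - y) = bidual_embedding x - bidual_embedding y"
  by (rule blinfun_eqI) (simp add: bidual_embedding.rep_eq blinfun.diff_left blinfun.diff_right)

lemma norm_bidual_embedding_le: "norm (bidual_embedding x) \<le> norm x"
proof (rule norm_blinfun_bound)
  show "norm (blinfun_apply (bidual_embedding x) f) \<le> norm x * norm f" for f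
    using norm_blinfun[of f x] by (simp add: bidual_embedding.rep_eq mult.commute)
qed simp

text \<open>The key use of the \<open>1\<close>-sum: \<open>\<zeta> - bidual_embedding y\<close> has norm at most \<open>t\<close> by lower semicontinuity,
and it decomposes as \<open>bidual_embedding (c - y) + \<xi>\<close>.\<close>

lemma chebyshev_sublevel_weak_star_limit:
  fixes Q A :: "'a::real_normed_vector set"
  assumes norm_add: "\<And>x \<xi>. \<xi> \<in> Xs \<Longrightarrow> norm (bidual_embedding x + \<xi>) = norm x + norm \<xi>"
    and limit: "\<zeta> \<in> bidual_weak_star closure_of (bidual_embedding ` {x \<in> Q. \<forall>y\<in>A. norm (x - y) \<le> t})"
    and \<zeta>: "\<zeta> = bidual_embedding c + \<xi>" "\<xi> \<in> Xs" and y: "y \<in> A" and t: "t \<ge> 0"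
  shows "norm (c - y) + norm \<xi> \<le> t"
proof -
  have "norm (\<zeta> - bidual_embedding y) \<le> t"
    using limit
  proof (rule forall_in_closure_of)
    fix z assume "z \<in> bidual_embedding ` {x \<in> Q. \<forall>y\<in>A. norm (x - y) \<le> t}"
    then obtain x where "z = bidual_embedding x" "norm (x - y) \<le> t" using y by auto
    then show "norm (z - bidual_embedding y) \<le> t"
      using norm_bidual_embedding_le[of "x - y"] by (simp add: bidual_embedding_diff)
  qed (use closedin_strong_operator_cball[OF t] in \<open>simp add: strong_operator_topology_topspace\<close>)
  moreover have "\<zeta> - bidual_embedding y = bidual_embedding (c - y) + \<xi>"
    by (simp add: \<zeta>(1) bidual_embedding_diff)
  ultimately show ?thesis using norm_add[OF \<zeta>(2), of "c - y"] by simp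
qed

text \<open>Here \<open>r\<close> stands for the Chebyshev radius, described by its two defining properties. A weak* limit
\<open>c + \<xi>\<close> common to all the sets of points of \<open>Q\<close> within \<open>r + 1 / (n + 1)\<close> of \<open>A\<close> yields a center \<open>c\<close>.
A weak* limit \<open>c + \<xi>\<close> of centers satisfies \<open>norm (c - y) \<le> r - norm \<xi>\<close> for all \<open>y\<close> in \<open>A\<close>, so
minimality of \<open>r\<close> forces \<open>\<xi> = 0\<close>: the set of centers is weak* closed in the bidual.\<close>

lemma L_embedded_sublevel_weakly_compact:
  fixes Q A :: "'a::real_normed_vector set"
  assumes Q: "L_embedded Q" and A: "A \<noteq> {}" and r: "r \<ge> 0"
    and nonempty: "\<And>e. e > 0 \<Longrightarrow> \<exists>x\<in>Q. \<forall>y\<in>A. norm (x - y) \<le> r + e"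
    and least: "\<And>x t. x \<in> Q \<Longrightarrow> \<forall>y\<in>A. norm (x - y) \<le> t \<Longrightarrow> r \<le> t"
  shows "{x \<in> Q. \<forall>y\<in>A. norm (x - y) \<le> r} \<noteq> {}"
    and "compactin weak_topology {x \<in> Q. \<forall>y\<in>A. norm (x - y) \<le> r}"
proof -
  let ?J = "bidual_embedding :: 'a \<Rightarrow> 'a bidual" and ?W = "bidual_weak_star :: 'a bidual topology"
  define E where "E t = {x \<in> Q. \<forall>y\<in>A. norm (x - y) \<le> t}" for t
  define D where "D t = ?W closure_of (?J ` E t)" for t
  obtain Xs :: "'a bidual set" where norm_add: "\<And>x \<xi>. \<xi> \<in> Xs \<Longrightarrow> norm (?J x + \<xi>) = norm x + norm \<xi>"
    and cl: "?W closure_of (?J ` Q) \<subseteq> {?J c + \<xi> |c \<xi>. c \<in> Q \<and> \<xi> \<in> Xs}"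
    using Q unfolding L_embedded_def by auto
  have split: "\<exists>c\<in>Q. \<exists>\<xi>\<in>Xs. \<zeta> = ?J c + \<xi>" if "\<zeta> \<in> D t" for \<zeta> t
  proof -
    have "D t \<subseteq> ?W closure_of (?J ` Q)"
      unfolding D_def by (intro closure_of_mono) (auto simp: E_def)
    with that cl show ?thesis by blast
  qed
  have bound: "norm (c - y) + norm \<xi> \<le> t" if "?J c + \<xi> \<in> D t" "\<xi> \<in> Xs" "y \<in> A" "t \<ge> 0" for c \<xi> y t
    using chebyshev_sublevel_weak_star_limit[of Xs, OF norm_add, of "?J c + \<xi>" Q A t c \<xi> y] that
    by (simp add: D_def E_def)
  obtain y0 where y0: "y0 \<in> A" using A by auto
  define B where "B = {\<phi> :: 'a bidual. norm \<phi> \<le> norm y0 + r + 1}"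
  have B: "compactin ?W B" unfolding B_def by (rule banach_alaoglu)
  have closedB: "closedin ?W B"
    unfolding B_def using closedin_strong_operator_cball[of "norm y0 + r + 1" "0 :: 'a bidual"] r by simp
  have DB: "D t \<subseteq> B" if "t \<le> r + 1" for t
    unfolding D_def
  proof (rule closure_of_minimal[OF _ closedB], clarify)
    fix x assume "x \<in> E t"
    then have "norm (x - y0) \<le> r + 1" using y0 that by (force simp: E_def)
    then have "norm x \<le> norm y0 + r + 1" using norm_triangle_sub[of x y0] by simp
    then show "?J x \<in> B" using norm_bidual_embedding_le[of x] by (simp add: B_def)
  qed
  show "{x \<in> Q. \<forall>y\<in>A. norm (x - y) \<le> r} \<noteq> {}"
  proof -
    have "(\<Inter>n. D (r + 1 / real (Suc n))) \<noteq> {}"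
    proof (rule compact_space_imp_nest[of "subtopology ?W B"])
      show "compact_space (subtopology ?W B)" using B by (rule compact_space_subtopology)
      show "closedin (subtopology ?W B) (D (r + 1 / real (Suc n)))" for n
        by (intro closedin_subset_topspace DB) (auto simp: D_def)
      show "D (r + 1 / real (Suc n)) \<noteq> {}" for n
      proof -
        obtain x where "x \<in> E (r + 1 / real (Suc n))"
          using nonempty[of "1 / real (Suc n)"] by (auto simp: E_def)
        then have "?J x \<in> D (r + 1 / real (Suc n))"
          unfolding D_def by (intro subsetD[OF closure_of_subset]) (auto simp: strong_operator_topology_topspace)
        then show ?thesis by auto
      qed
      show "decseq (\<lambda>n. D (r + 1 / real (Suc n)))"
      proof (rule decseq_SucI)
        fix n
        have "1 / real (Suc (Suc n)) \<le> 1 / real (Suc n)" by (simp add: field_simps)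
        then show "D (r + 1 / real (Suc (Suc n))) \<subseteq> D (r + 1 / real (Suc n))"
          unfolding D_def by (intro closure_of_mono image_mono) (force simp: E_def)
      qed
    qed
    then obtain \<zeta> where \<zeta>: "\<And>n. \<zeta> \<in> D (r + 1 / real (Suc n))" by auto
    obtain c \<xi> where c: "c \<in> Q" "\<xi> \<in> Xs" "\<zeta> = ?J c + \<xi>" using split[OF \<zeta>] by auto
    have "norm (c - y) \<le> r" if "y \<in> A" for y
    proof (rule field_le_epsilon)
      fix e :: real assume "e > 0"
      then obtain n where "1 / real (Suc n) < e" using nat_approx_posE by blast
      moreover have "norm (c - y) + norm \<xi> \<le> r + 1 / real (Suc n)"
        using \<zeta>[of n] r unfolding c(3) by (intro bound c(2) that) auto
      ultimately show "norm (c - y) \<le> r + e" by simp (smt (verit) norm_ge_zero)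
    qed
    with c(1) show ?thesis by auto
  qed
  have "D r \<subseteq> ?J ` E r"
  proof
    fix \<zeta> assume \<zeta>: "\<zeta> \<in> D r"
    obtain c \<xi> where c: "c \<in> Q" "\<xi> \<in> Xs" "\<zeta> = ?J c + \<xi>" using split[OF \<zeta>] by auto
    have *: "norm (c - y) + norm \<xi> \<le> r" if "y \<in> A" for y
      using \<zeta> r unfolding c(3) by (intro bound c(2) that) auto
    have "r \<le> r - norm \<xi>"
      using * by (intro least[OF c(1)]) (auto simp: algebra_simps)
    then have "\<xi> = 0" by simp
    with c * show "\<zeta> \<in> ?J ` E r" by (auto simp: E_def)
  qed
  moreover have "?J ` E r \<subseteq> D r"
    unfolding D_def by (intro closure_of_subset) (auto simp: strong_operator_topology_topspace)
  ultimately have "?J ` E r = D r" by auto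
  moreover have "compactin ?W (D r)"
  proof (rule closed_compactin[OF B])
    show "D r \<subseteq> B" by (rule DB) simp
    show "closedin ?W (D r)" by (simp add: D_def)
  qed
  ultimately have "compactin ?W (?J ` E r)" by simp
  then have "compactin weak_topology (E r)"
    unfolding weak_topology_pullback_bidual by (rule compactin_pullback_topology)
  then show "compactin weak_topology {x \<in> Q. \<forall>y\<in>A. norm (x - y) \<le> r}" by (simp add: E_def)
qed

lemma chebyshev_center_L_embedded:
  fixes Q A :: "'a::real_normed_vector set"
  assumes Q: "L_embedded Q" and A: "A \<noteq> {}" "bounded A"
  shows "chebyshev_center Q A = {x \<in> Q. \<forall>y\<in>A. norm (x - y) \<le> chebyshev_radius Q A}"
    and "chebyshev_center Q A \<noteq> {}"
    and "compactin weak_topology (chebyshev_center Q A)"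
proof -
  define \<rho> where "\<rho> x = (SUP y\<in>A. norm (x - y))" for x
  define r where "r = chebyshev_radius Q A"
  have r_def': "r = (INF x\<in>Q. \<rho> x)" by (simp add: r_def chebyshev_radius_def \<rho>_def)
  obtain M where M: "\<And>y. y \<in> A \<Longrightarrow> norm y \<le> M" using A(2) by (auto simp: bounded_iff)
  have bdd: "bdd_above ((\<lambda>y. norm (x - y)) ` A)" for x
    using M by (intro bdd_aboveI2[of _ _ "norm x + M"]) (meson add_left_mono norm_triangle_ineq4 order_trans)
  have upper: "norm (x - y) \<le> \<rho> x" if "y \<in> A" for x y
    unfolding \<rho>_def using that by (intro cSUP_upper bdd)
  have lub: "\<rho> x \<le> t" if "\<forall>y\<in>A. norm (x - y) \<le> t" for x t
    unfolding \<rho>_def using that A(1) by (intro cSUP_least) auto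
  have nonneg: "0 \<le> \<rho> x" for x using A(1) upper norm_ge_zero order_trans by blast
  have Qne: "Q \<noteq> {}" using Q by (simp add: L_embedded_def)
  have inf: "r \<le> \<rho> x" if "x \<in> Q" for x
    unfolding r_def' using that nonneg by (intro cINF_lower bdd_belowI2[of _ 0])
  have r0: "0 \<le> r" unfolding r_def' using Qne nonneg by (intro cINF_greatest)
  have near: "\<exists>x\<in>Q. \<forall>y\<in>A. norm (x - y) \<le> r + e" if "e > 0" for e
  proof -
    have "\<exists>x\<in>Q. \<rho> x < r + e"
    proof (rule ccontr)
      assume "\<not> ?thesis"
      then have "r + e \<le> r" by (subst (2) r_def') (intro cINF_greatest Qne, auto simp: not_less)
      with that show False by simp
    qed
    then show ?thesis using upper by (meson less_imp_le order_trans)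
  qed
  have least: "r \<le> t" if "x \<in> Q" "\<forall>y\<in>A. norm (x - y) \<le> t" for x t
    using inf[OF that(1)] lub[OF that(2)] by simp
  show *: "chebyshev_center Q A = {x \<in> Q. \<forall>y\<in>A. norm (x - y) \<le> chebyshev_radius Q A}"
    unfolding chebyshev_center_def r_def[symmetric] \<rho>_def[symmetric]
    using upper lub inf by (auto intro: antisym)
  show "chebyshev_center Q A \<noteq> {}" "compactin weak_topology (chebyshev_center Q A)"
    unfolding * r_def[symmetric]
    by (rule L_embedded_sublevel_weakly_compact[OF Q A(1) r0 near least]; assumption)+
qed

section \<open>Separability of the span of a countable set\<close>

lemma subspace_closure:
  fixes V :: "'a::real_normed_vector set"
  assumes V: "subspace V"
  shows "subspace (closure V)"
proof (rule subspaceI)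
  show "0 \<in> closure V" using subspace_0[OF V] closure_subset by auto
  fix x y assume "x \<in> closure V" "y \<in> closure V"
  then obtain a b where a: "\<And>n. a n \<in> V" "a \<longlonglongrightarrow> x" and b: "\<And>n. b n \<in> V" "b \<longlonglongrightarrow> y"
    unfolding closure_sequential by blast
  show "x + y \<in> closure V"
    unfolding closure_sequential using a b
    by (intro exI[of _ "\<lambda>n. a n + b n"]) (auto intro: tendsto_add subspace_add[OF V])
  show "c *\<^sub>R x \<in> closure V" for c
    unfolding closure_sequential using a
    by (intro exI[of _ "\<lambda>n. c *\<^sub>R a n"]) (auto intro: tendsto_scaleR subspace_scale[OF V])
qed

text \<open>The dense set consists of the linear combinations with rational coefficients.\<close>

lemma countable_dense_subset_of_span:
  fixes B :: "'a::real_normed_vector set"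
  assumes "countable B"
  obtains D where "countable D" "span B \<subseteq> closure D"
proof
  define g where "g = (\<lambda>w :: (real \<times> 'a) list. \<Sum>(q, b)\<leftarrow>w. q *\<^sub>R b)"
  define D where "D = g ` lists (\<rat> \<times> B)"
  show "countable D"
    unfolding D_def using assms countable_rat by (intro countable_image countable_lists countable_SIGMA) auto
  show "span B \<subseteq> closure D"
  proof
    fix x assume "x \<in> span B"
    then show "x \<in> closure D"
    proof (induction rule: span_induct_alt)
      case base
      have "g [] \<in> D" unfolding D_def by (intro imageI) auto
      then show ?case using closure_subset by (auto simp: g_def)
    next
      case (step c b y)
      show ?case
        unfolding closure_approachable
      proof (intro allI impI)
        fix e :: real assume e: "e > 0"
        obtain z where z: "z \<in> D" "dist z y < e / 2"
          using step.IH e by (meson closure_approachable half_gt_zero)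
        then obtain w where w: "w \<in> lists (\<rat> \<times> B)" "z = g w" by (auto simp: D_def)
        define k where "k = norm b + 1"
        have k: "k > 0" by (simp add: k_def add_nonneg_pos)
        then have "c < c + e / 2 / k" using e by simp
        then obtain q where q: "q \<in> \<rat>" "c < q" "q < c + e / 2 / k"
          using Rats_dense_in_real by blast
        have "\<bar>q - c\<bar> * norm b \<le> \<bar>q - c\<bar> * k" by (intro mult_left_mono) (auto simp: k_def)
        also have "\<dots> < e / 2"
          using pos_less_divide_eq[OF k, of "\<bar>q - c\<bar>" "e / 2"] q(2,3) by simp
        finally have qc: "norm ((q - c) *\<^sub>R b) < e / 2" by simp
        have "dist (q *\<^sub>R b + z) (c *\<^sub>R b + y) = norm ((q - c) *\<^sub>R b + (z - y))"
          by (simp add: dist_norm algebra_simps)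
        also have "\<dots> < e" using norm_triangle_ineq[of "(q - c) *\<^sub>R b" "z - y"] qc z(2)
          by (simp add: dist_norm)
        finally have "dist (q *\<^sub>R b + z) (c *\<^sub>R b + y) < e" .
        moreover have "q *\<^sub>R b + z = g ((q, b) # w)" by (simp add: g_def w)
        moreover have "g ((q, b) # w) \<in> D" unfolding D_def using q w step.hyps by (intro imageI) auto
        ultimately show "\<exists>v\<in>D. dist v (c *\<^sub>R b + y) < e" by metis
      qed
    qed
  qed
qed

section \<open>Countable distal semigroups of nonexpansive maps\<close>

text \<open>The positive lower bound for \<open>norm (T x - T y)\<close> says that \<open>0\<close> is not in the norm closure of the
differences \<open>T x - T y\<close>. Adding the identity to a semigroup preserves this.\<close>

locale distal_nonexpansive_semigroup =
  fixes K :: "'a::real_normed_vector set" and \<T> :: "('a \<Rightarrow> 'a) set"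
  assumes compact: "compactin weak_topology K"
    and countable: "countable \<T>"
    and id: "id \<in> \<T>"
    and comp: "S \<in> \<T> \<Longrightarrow> T \<in> \<T> \<Longrightarrow> S \<circ> T \<in> \<T>"
    and cont: "T \<in> \<T> \<Longrightarrow> continuous_map (subtopology weak_topology K) (subtopology weak_topology K) T"
    and nonexpansive: "T \<in> \<T> \<Longrightarrow> x \<in> K \<Longrightarrow> y \<in> K \<Longrightarrow> norm (T x - T y) \<le> norm (x - y)"
    and distal: "x \<in> K \<Longrightarrow> y \<in> K \<Longrightarrow> x \<noteq> y \<Longrightarrow> \<exists>\<delta>>0. \<forall>T\<in>\<T>. \<delta> \<le> norm (T x - T y)"
begin

definition invariant :: "'a set \<Rightarrow> bool" where
  "invariant M \<longleftrightarrow> closedin weak_topology M \<and> M \<noteq> {} \<and> M \<subseteq> K \<and> (\<forall>T\<in>\<T>. T ` M \<subseteq> M)"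

text \<open>Minimal in the sense of topological dynamics, without convexity.\<close>

definition minimal :: "'a set \<Rightarrow> bool" where
  "minimal F \<longleftrightarrow> invariant F \<and> (\<forall>C. invariant C \<longrightarrow> C \<subseteq> F \<longrightarrow> C = F)"

lemma invariantD: "invariant M \<Longrightarrow> T \<in> \<T> \<Longrightarrow> x \<in> M \<Longrightarrow> T x \<in> M"
  by (auto simp: invariant_def)

lemma closed: "closedin weak_topology K"
  using compactin_imp_closedin[OF Hausdorff_weak_topology compact] .

lemma compact_invariant: "invariant M \<Longrightarrow> compactin weak_topology M"
  using closed_compactin[OF compact] by (auto simp: invariant_def)

lemma cont_invariant:
  assumes "T \<in> \<T>" "invariant M"
  shows "continuous_map (subtopology weak_topology M) (subtopology weak_topology M) T"
proof -
  have M: "M \<subseteq> K" "T ` M \<subseteq> M" using assms by (auto simp: invariant_def)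
  have "continuous_map (subtopology weak_topology K) weak_topology T"
    using cont[OF assms(1)] by (simp add: continuous_map_in_subtopology)
  then have "continuous_map (subtopology weak_topology M) weak_topology T"
    using M(1) by (rule continuous_map_from_subtopology_mono)
  then show ?thesis using M(2) by (auto simp: continuous_map_in_subtopology)
qed

text \<open>The property \<open>P\<close> allows for invariant sets with additional structure, here convexity.\<close>

lemma minimal_invariant_subset:
  assumes K': "P K'" and P: "\<And>C. P C \<Longrightarrow> invariant C"
    and Inter: "\<And>\<C>. \<C> \<noteq> {} \<Longrightarrow> (\<And>C. C \<in> \<C> \<Longrightarrow> P C) \<Longrightarrow> invariant (\<Inter>\<C>) \<Longrightarrow> P (\<Inter>\<C>)"
  obtains M where "P M" "M \<subseteq> K'" "\<And>C. P C \<Longrightarrow> C \<subseteq> M \<Longrightarrow> C = M"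
proof (rule minimal_nonempty_closed_set[of "subtopology weak_topology K" P K'])
  show "compact_space (subtopology weak_topology K)" using compact by (rule compact_space_subtopology)
  show "closedin (subtopology weak_topology K) C \<and> C \<noteq> {}" if "P C" for C
    using P[OF that] by (auto simp: invariant_def intro: closedin_subset_topspace)
  show "P (\<Inter>\<C>)" if "\<C> \<noteq> {}" "\<And>C. C \<in> \<C> \<Longrightarrow> P C" "\<Inter>\<C> \<noteq> {}" for \<C>
  proof (rule Inter[OF that(1,2)])
    have inv: "invariant C" if "C \<in> \<C>" for C using P \<open>\<And>C. C \<in> \<C> \<Longrightarrow> P C\<close> that by blast
    show "invariant (\<Inter>\<C>)"
      unfolding invariant_def
    proof (intro conjI ballI)
      show "closedin weak_topology (\<Inter>\<C>)" using inv that(1) by (intro closedin_Inter) (auto simp: invariant_def)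
      show "\<Inter>\<C> \<subseteq> K" using inv that(1) by (auto simp: invariant_def)
      show "T ` \<Inter>\<C> \<subseteq> \<Inter>\<C>" if "T \<in> \<T>" for T
        using inv that by (fastforce simp: invariant_def)
    qed (fact that(3))
  qed
qed (use K' that in auto)

lemma exists_minimal:
  assumes "invariant K'"
  obtains F where "minimal F" "F \<subseteq> K'"
  by (rule minimal_invariant_subset[of invariant K']) (use assms in \<open>auto simp: minimal_def\<close>)

lemma minimal_orbit_closure:
  assumes F: "minimal F" and x: "x \<in> F"
  shows "weak_topology closure_of ((\<lambda>T. T x) ` \<T>) = F"
proof -
  have inv: "invariant F" using F by (simp add: minimal_def)
  define B where "B = (\<lambda>T. T x) ` \<T>"
  define C where "C = weak_topology closure_of B"
  have BF: "B \<subseteq> F" using inv x by (auto simp: invariant_def B_def)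
  have CF: "C \<subseteq> F" unfolding C_def using inv BF by (intro closure_of_minimal) (auto simp: invariant_def)
  have BC: "B \<subseteq> C" unfolding C_def by (intro closure_of_subset) simp
  have C_eq: "subtopology weak_topology F closure_of B = C"
    using BF CF by (simp add: closure_of_subtopology C_def inf.absorb2)
  have "T ` C \<subseteq> C" if T: "T \<in> \<T>" for T
  proof -
    have "T ` C \<subseteq> subtopology weak_topology F closure_of (T ` B)"
      using continuous_map_image_closure_subset[OF cont_invariant[OF T inv], of B] by (simp add: C_eq)
    also have "\<dots> \<subseteq> subtopology weak_topology F closure_of B"
    proof (rule closure_of_mono)
      show "T ` B \<subseteq> B" unfolding B_def using comp[OF T] by (force intro: image_eqI[OF _ comp[OF T]])
    qed
    finally show ?thesis by (simp add: C_eq)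
  qed
  moreover have "C \<noteq> {}" using BC id by (auto simp: B_def)
  ultimately have "invariant C"
    using CF inv by (auto simp: invariant_def C_def)
  then show ?thesis using F CF by (simp add: minimal_def C_def B_def)
qed

lemma minimal_orbit_meets_open:
  assumes F: "minimal F" and x: "x \<in> F" and U: "openin weak_topology U" "U \<inter> F \<noteq> {}"
  obtains T where "T \<in> \<T>" "T x \<in> U"
proof -
  obtain y where "y \<in> U" "y \<in> weak_topology closure_of ((\<lambda>T. T x) ` \<T>)"
    using U(2) minimal_orbit_closure[OF F x] by auto
  then show ?thesis using U(1) that unfolding in_closure_of by blast
qed

text \<open>\<open>F\<close> is the weak closure of a countable orbit, hence lies in the norm closure of a countable set
\<open>D\<close>. The balls of radius \<open>e / 2\<close> around points of \<open>D\<close> are weakly closed and cover the compact space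
\<open>F\<close>, so by Baire's theorem the trace of one of them has nonempty weak interior in \<open>F\<close>.\<close>

lemma minimal_small_open:
  assumes F: "minimal F" and e: "e > 0"
  obtains U where "openin weak_topology U" "U \<inter> F \<noteq> {}"
    "\<And>x y. x \<in> U \<inter> F \<Longrightarrow> y \<in> U \<inter> F \<Longrightarrow> norm (x - y) \<le> e"
proof -
  have inv: "invariant F" using F by (simp add: minimal_def)
  then obtain x where x: "x \<in> F" by (auto simp: invariant_def)
  define B where "B = (\<lambda>T. T x) ` \<T>"
  have "countable B" using countable by (simp add: B_def)
  then obtain D where D: "countable D" "span B \<subseteq> closure D" by (rule countable_dense_subset_of_span)
  have "F \<subseteq> closure (span B)"
    unfolding minimal_orbit_closure[OF F x, symmetric] B_def[symmetric]
    by (intro closure_of_minimal closedin_weak_closed_subspace subspace_closure subspace_span)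
      (auto intro: subsetD[OF closure_subset] span_base)
  also have "\<dots> \<subseteq> closure D" using D(2) by (simp add: closure_minimal)
  finally have FD: "F \<subseteq> closure D" .
  define X where "X = subtopology weak_topology F"
  have X: "compact_space X" "Hausdorff_space X"
    using compact_space_subtopology[OF compact_invariant[OF inv]] Hausdorff_space_subtopology[OF Hausdorff_weak_topology]
    by (auto simp: X_def)
  define \<G> where "\<G> = (\<lambda>d. F \<inter> cball d (e / 2)) ` D"
  have "\<exists>G\<in>\<G>. X interior_of G \<noteq> {}"
  proof (rule ccontr)
    assume "\<not> ?thesis"
    then have "X interior_of \<Union>\<G> = {}"
    proof (intro Baire_category_alt)
      show "completely_metrizable_space X \<or> locally_compact_space X \<and> regular_space X"
        using X compact_imp_locally_compact_space compact_Hausdorff_imp_regular_space by blast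
      show "countable \<G>" using D(1) by (simp add: \<G>_def)
      show "closedin X G \<and> X interior_of G = {}" if "G \<in> \<G>" for G
        using that \<open>\<not> (\<exists>G\<in>\<G>. X interior_of G \<noteq> {})\<close>
        by (auto simp: \<G>_def X_def closedin_subtopology Int_commute intro: closedin_weak_cball)
    qed
    moreover have "F \<subseteq> \<Union>\<G>"
    proof
      fix y assume "y \<in> F"
      then obtain d where "d \<in> D" "dist d y < e / 2"
        using FD e by (meson closure_approachable half_gt_zero subsetD)
      then show "y \<in> \<Union>\<G>" using \<open>y \<in> F\<close> by (auto simp: \<G>_def intro!: bexI[of _ d])
    qed
    then have "\<Union>\<G> = topspace X" by (auto simp: X_def \<G>_def)
    ultimately have "topspace X = {}" by (metis interior_of_topspace)
    then show False using x by (auto simp: X_def)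
  qed
  then obtain d where "X interior_of (F \<inter> cball d (e / 2)) \<noteq> {}" by (auto simp: \<G>_def)
  then obtain V where V: "openin X V" "V \<noteq> {}" "V \<subseteq> F \<inter> cball d (e / 2)"
    by (meson interior_of_subset openin_interior_of)
  then obtain U where U: "openin weak_topology U" "V = U \<inter> F" by (auto simp: X_def openin_subtopology)
  show ?thesis
  proof (rule that[OF U(1)])
    show "U \<inter> F \<noteq> {}" using V U by simp
    fix a b assume "a \<in> U \<inter> F" "b \<in> U \<inter> F"
    then have "dist d a \<le> e / 2" "dist d b \<le> e / 2" using V(3) U(2) by auto
    then have "dist a b \<le> e" using dist_triangle2[of a b d] by (simp add: dist_commute)
    then show "norm (a - b) \<le> e" by (simp add: dist_norm)
  qed
qed

lemma funpow_mem: "s \<in> \<T> \<Longrightarrow> s ^^ n \<in> \<T>"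
  by (induction n) (auto simp: id comp)

text \<open>If \<open>s ^^ n\<close> brings \<open>x\<close> and \<open>y\<close> weakly close to \<open>z\<close>, choose \<open>T\<close> moving \<open>z\<close> into a weakly open set of
norm diameter at most \<open>\<delta> / 2\<close>. By weak continuity \<open>T \<circ> s ^^ n\<close> moves \<open>x\<close> and \<open>y\<close> into that set,
contradicting norm-distality.\<close>

lemma minimal_proximal_imp_eq:
  assumes F: "minimal F" and s: "s \<in> \<T>" and xyz: "x \<in> F" "y \<in> F" "z \<in> F"
    and proximal: "\<And>U. openin (subtopology weak_topology F) U \<Longrightarrow> z \<in> U \<Longrightarrow>
      \<exists>n\<ge>1. (s ^^ n) x \<in> U \<and> (s ^^ n) y \<in> U"
  shows "x = y"
proof (rule ccontr)
  assume "x \<noteq> y"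
  have inv: "invariant F" using F by (simp add: minimal_def)
  then have "x \<in> K" "y \<in> K" using xyz by (auto simp: invariant_def)
  with \<open>x \<noteq> y\<close> obtain \<delta> where \<delta>: "\<delta> > 0" "\<And>T. T \<in> \<T> \<Longrightarrow> \<delta> \<le> norm (T x - T y)"
    using distal by metis
  obtain U where U: "openin weak_topology U" "U \<inter> F \<noteq> {}"
    "\<And>x y. x \<in> U \<inter> F \<Longrightarrow> y \<in> U \<inter> F \<Longrightarrow> norm (x - y) \<le> \<delta> / 2"
    using minimal_small_open[OF F, of "\<delta> / 2"] \<delta>(1) by auto
  obtain T where T: "T \<in> \<T>" "T z \<in> U" using minimal_orbit_meets_open[OF F xyz(3) U(1,2)] .
  have "continuous_map (subtopology weak_topology F) weak_topology T"
    using cont_invariant[OF T(1) inv] by (simp add: continuous_map_in_subtopology)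
  then have "openin (subtopology weak_topology F) {w \<in> topspace (subtopology weak_topology F). T w \<in> U}"
    using U(1) by (rule openin_continuous_map_preimage)
  then obtain n where n: "T ((s ^^ n) x) \<in> U" "T ((s ^^ n) y) \<in> U"
    using proximal T(2) xyz(3) by fastforce
  have Tn: "T \<circ> s ^^ n \<in> \<T>" using comp[OF T(1) funpow_mem[OF s]] .
  then have "(T \<circ> s ^^ n) x \<in> F" "(T \<circ> s ^^ n) y \<in> F" using invariantD[OF inv Tn] xyz by blast+
  then have "norm ((T \<circ> s ^^ n) x - (T \<circ> s ^^ n) y) \<le> \<delta> / 2" using n by (intro U(3)) auto
  with \<delta>(2)[OF Tn] \<delta>(1) show False by simp
qed

lemma minimal_recurrent:
  assumes F: "minimal F" and s: "s \<in> \<T>" and xy: "x \<in> F" "y \<in> F"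
    and U: "openin weak_topology U" "x \<in> U" and V: "openin weak_topology V" "y \<in> V"
  obtains n where "n \<ge> 1" "(s ^^ n) x \<in> U" "(s ^^ n) y \<in> V"
proof -
  let ?X = "subtopology weak_topology F"
  have inv: "invariant F" using F by (simp add: minimal_def)
  obtain n where "n \<ge> 1" "(s ^^ n) x \<in> F \<inter> U" "(s ^^ n) y \<in> F \<inter> V"
  proof (rule distal_map_recurrent[where X = ?X and s = s and x = x and y = y and U = "F \<inter> U" and V = "F \<inter> V"])
    show "compact_space ?X" by (rule compact_space_subtopology[OF compact_invariant[OF inv]])
    show "Hausdorff_space ?X" by (rule Hausdorff_space_subtopology[OF Hausdorff_weak_topology])
    show "continuous_map ?X ?X s" by (rule cont_invariant[OF s inv])
    show "a = b" if "a \<in> topspace ?X" "b \<in> topspace ?X" "c \<in> topspace ?X"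
        "\<And>U. openin ?X U \<Longrightarrow> c \<in> U \<Longrightarrow> \<exists>n\<ge>1. (s ^^ n) a \<in> U \<and> (s ^^ n) b \<in> U" for a b c
      using that by (intro minimal_proximal_imp_eq[OF F s, of a b c]) auto
  qed (use xy U V in \<open>auto intro: openin_subtopology_Int2\<close>)
  then show ?thesis using that by auto
qed

text \<open>For \<open>n \<ge> 1\<close> the distance of \<open>(s ^^ n) x\<close> and \<open>(s ^^ n) y\<close> is at most \<open>norm (s x - s y)\<close>. By recurrence
and weak lower semicontinuity of the norm it also comes arbitrarily close to \<open>norm (x - y)\<close>.\<close>

lemma minimal_isometry:
  assumes F: "minimal F" and s: "s \<in> \<T>" and xy: "x \<in> F" "y \<in> F"
  shows "norm (s x - s y) = norm (x - y)"
proof (rule antisym)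
  have inv: "invariant F" using F by (simp add: minimal_def)
  then have K: "F \<subseteq> K" by (simp add: invariant_def)
  have FF: "(s ^^ n) a \<in> F" if "a \<in> F" for a n
    using inv funpow_mem[OF s, of n] that by (auto simp: invariant_def)
  show "norm (s x - s y) \<le> norm (x - y)" using nonexpansive s xy K by auto
  have dec: "norm ((s ^^ n) x - (s ^^ n) y) \<le> norm (s x - s y)" if "n \<ge> 1" for n
    using that
  proof (induction n rule: dec_induct)
    case (step n)
    have "norm ((s ^^ Suc n) x - (s ^^ Suc n) y) \<le> norm ((s ^^ n) x - (s ^^ n) y)"
      using nonexpansive[OF s, of "(s ^^ n) x" "(s ^^ n) y"] FF xy K by auto
    with step show ?case by simp
  qed simp
  show "norm (x - y) \<le> norm (s x - s y)"
  proof (rule ccontr)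
    assume less: "\<not> ?thesis"
    obtain f where f: "blinfun_apply f (x - y) = norm (x - y)" "norm f \<le> 1" by (rule norming_functional)
    define \<eta> where "\<eta> = (norm (x - y) - norm (s x - s y)) / 2"
    have \<eta>: "\<eta> > 0" using less by (simp add: \<eta>_def)
    obtain n where n: "n \<ge> 1" "(s ^^ n) x \<in> {z. blinfun_apply f x - \<eta> < blinfun_apply f z}"
        "(s ^^ n) y \<in> {z. blinfun_apply f z < blinfun_apply f y + \<eta>}"
      by (rule minimal_recurrent[OF F s xy openin_weak_greater _ openin_weak_less]) (use \<eta> in auto)
    have "norm (x - y) - 2 * \<eta> < blinfun_apply f ((s ^^ n) x - (s ^^ n) y)"
      using n(2,3) f(1) by (simp add: blinfun.diff_right)
    also have "\<dots> \<le> norm ((s ^^ n) x - (s ^^ n) y)" by (rule blinfun_le_norm[OF f(2)])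
    also have "\<dots> \<le> norm (s x - s y)" by (rule dec[OF n(1)])
    finally show False by (simp add: \<eta>_def field_simps)
  qed
qed

text \<open>A point of \<open>F\<close> outside the weakly closed set \<open>s ` F\<close> would have to return to its complement, while
all iterates \<open>s ^^ n\<close> with \<open>n \<ge> 1\<close> map into \<open>s ` F\<close>.\<close>

lemma minimal_surj:
  assumes F: "minimal F" and s: "s \<in> \<T>"
  shows "s ` F = F"
proof
  have inv: "invariant F" using F by (simp add: minimal_def)
  show "s ` F \<subseteq> F" using inv s by (auto simp: invariant_def)
  have "compactin weak_topology (s ` F)"
  proof (rule image_compactin)
    show "compactin (subtopology weak_topology F) F"
      using compact_invariant[OF inv] by (simp add: compactin_subtopology)
    show "continuous_map (subtopology weak_topology F) weak_topology s"
      using cont_invariant[OF s inv] by (simp add: continuous_map_in_subtopology)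
  qed
  then have "closedin weak_topology (s ` F)" by (rule compactin_imp_closedin[OF Hausdorff_weak_topology])
  then have op: "openin weak_topology (- (s ` F))" by (simp add: closedin_def Compl_eq_Diff_UNIV)
  show "F \<subseteq> s ` F"
  proof (rule ccontr)
    assume "\<not> F \<subseteq> s ` F"
    then obtain x where x: "x \<in> F" "x \<in> - (s ` F)" by auto
    obtain n where n: "n \<ge> 1" "(s ^^ n) x \<in> - (s ` F)"
      using minimal_recurrent[OF F s x(1) x(1) op x(2) op x(2)] .
    then obtain m where "n = Suc m" by (cases n) auto
    moreover have "(s ^^ m) x \<in> F" using inv funpow_mem[OF s, of m] x(1) by (auto simp: invariant_def)
    ultimately show False using n(2) by auto
  qed
qed

text \<open>By minimality the sets of points that some \<open>T\<close> moves into a small weakly open \<open>U\<close> cover \<open>F\<close>, and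
finitely many of them suffice. Since \<open>T\<close> is isometric on \<open>F\<close>, each has norm diameter at most \<open>e\<close>.\<close>

lemma minimal_finite_net:
  assumes F: "minimal F" and e: "e > 0"
  obtains C where "finite C" "C \<subseteq> F" "\<And>y. y \<in> F \<Longrightarrow> \<exists>c\<in>C. norm (y - c) \<le> e"
proof -
  let ?X = "subtopology weak_topology F"
  have inv: "invariant F" using F by (simp add: minimal_def)
  obtain U where U: "openin weak_topology U" "U \<inter> F \<noteq> {}"
    "\<And>x y. x \<in> U \<inter> F \<Longrightarrow> y \<in> U \<inter> F \<Longrightarrow> norm (x - y) \<le> e"
    using minimal_small_open[OF F e] by blast
  define W where "W T = {w \<in> F. T w \<in> U}" for T
  have "\<exists>\<F>. finite \<F> \<and> \<F> \<subseteq> W ` \<T> \<and> F \<subseteq> \<Union>\<F>"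
  proof (rule compactinD)
    show "compactin ?X F" using compact_invariant[OF inv] by (simp add: compactin_subtopology)
    show "F \<subseteq> \<Union>(W ` \<T>)"
    proof
      fix x assume x: "x \<in> F"
      obtain T where "T \<in> \<T>" "T x \<in> U" using minimal_orbit_meets_open[OF F x U(1,2)] .
      with x show "x \<in> \<Union>(W ` \<T>)" by (auto simp: W_def)
    qed
    fix V assume "V \<in> W ` \<T>"
    then obtain T where T: "T \<in> \<T>" "V = W T" by auto
    have "continuous_map ?X weak_topology T"
      using cont_invariant[OF T(1) inv] by (simp add: continuous_map_in_subtopology)
    from openin_continuous_map_preimage[OF this U(1)] show "openin ?X V" by (simp add: T(2) W_def)
  qed
  then obtain \<S> where \<S>: "finite \<S>" "\<S> \<subseteq> \<T>" "F \<subseteq> \<Union>(W ` \<S>)"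
    by (metis finite_subset_image)
  define c where "c T = (SOME w. w \<in> W T)" for T
  have c: "c T \<in> W T" if "w \<in> W T" for T w unfolding c_def using that by (rule someI)
  show ?thesis
  proof (rule that[of "c ` {T \<in> \<S>. W T \<noteq> {}}"])
    show "finite (c ` {T \<in> \<S>. W T \<noteq> {}})" using \<S>(1) by simp
    show "c ` {T \<in> \<S>. W T \<noteq> {}} \<subseteq> F" using c by (auto simp: W_def)
    fix y assume y: "y \<in> F"
    then obtain T where T: "T \<in> \<S>" "y \<in> W T" using \<S>(3) by auto
    have "c T \<in> F" "T (c T) \<in> U" "T y \<in> U" using c[OF T(2)] T(2) by (auto simp: W_def)
    moreover have "T \<in> \<T>" using T(1) \<S>(2) by auto
    moreover have "T y \<in> F" "T (c T) \<in> F" using inv y calculation by (auto simp: invariant_def)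
    ultimately have "norm (y - c T) \<le> e"
      using U(3)[of "T y" "T (c T)"] minimal_isometry[OF F, of T y "c T"] y by simp
    then show "\<exists>c\<in>c ` {T \<in> \<S>. W T \<noteq> {}}. norm (y - c) \<le> e" using T by auto
  qed
qed

text \<open>A minimal set \<open>F\<close> with two points has a point \<open>u\<close> of the minimal convex set \<open>M\<close> whose distances to \<open>F\<close>
are bounded by some \<open>r\<close> below the diameter of \<open>F\<close>. As \<open>T ` F = F\<close> for all \<open>T\<close>, the set \<open>M'\<close> of all such
points of \<open>M\<close> is invariant, hence is \<open>M\<close> and contains \<open>F\<close>.\<close>

lemma common_fixed_point:
  assumes K: "convex K" "bounded K" "K \<noteq> {}"
  obtains x where "x \<in> K" "\<And>T. T \<in> \<T> \<Longrightarrow> T x = x"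
proof -
  have "invariant K"
    using cont closed K(3) by (fastforce simp: invariant_def continuous_map_def)
  then obtain M where M: "invariant M" "convex M"
    and min: "\<And>C. invariant C \<and> convex C \<Longrightarrow> C \<subseteq> M \<Longrightarrow> C = M"
    using K(1) minimal_invariant_subset[of "\<lambda>C. invariant C \<and> convex C" K] convex_Inter by (smt (verit))
  obtain F where F: "minimal F" "F \<subseteq> M" using exists_minimal[OF M(1)] .
  have inv: "invariant F" using F by (simp add: minimal_def)
  then obtain x where x: "x \<in> F" by (auto simp: invariant_def)
  have MK: "M \<subseteq> K" using M by (simp add: invariant_def)
  have "F = {x}"
  proof (rule ccontr)
    assume "F \<noteq> {x}"
    then obtain y where y: "y \<in> F" "y \<noteq> x" using x by auto
    define d where "d = diameter F"
    have bF: "bounded F" using F(2) MK K(2) bounded_subset by blast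
    have diam: "norm (a - b) \<le> d" if "a \<in> F" "b \<in> F" for a b
      using diameter_bounded_bound[OF bF that] by (simp add: d_def dist_norm)
    have "0 < norm (x - y)" using y by simp
    then have d: "d > 0" using diam[OF x y(1)] by linarith
    obtain C where C: "finite C" "C \<subseteq> F" "\<And>y. y \<in> F \<Longrightarrow> \<exists>c\<in>C. norm (y - c) \<le> d / 2"
      using minimal_finite_net[OF F(1), of "d / 2"] d by auto
    define n where "n = real (card C)"
    have "C \<noteq> {}" using C(3)[OF x] by auto
    then have n: "n > 0" using C(1) by (simp add: n_def card_gt_0_iff)
    define u where "u = (\<Sum>c\<in>C. (1 / n) *\<^sub>R c)"
    \<comment> \<open>Of the \<open>n\<close> net points averaged in \<open>u\<close>, one is within \<open>d / 2\<close> of a given point of \<open>F\<close> and the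
      others are within \<open>d\<close>.\<close>
    define r where "r = d - d / (2 * n)"
    have "u \<in> M"
      unfolding u_def using C(1,2) F(2) n by (intro convex_sum M(2)) (auto simp: n_def)
    have ur: "norm (y - u) \<le> r" if y: "y \<in> F" for y
    proof -
      obtain c0 where c0: "c0 \<in> C" "norm (y - c0) \<le> d / 2" using C(3)[OF y] by auto
      have "y = (\<Sum>c\<in>C. (1 / n) *\<^sub>R y)" using n by (simp add: n_def scaleR_left.sum[symmetric])
      then have "y - u = (\<Sum>c\<in>C. (1 / n) *\<^sub>R (y - c))"
        by (metis (mono_tags, lifting) u_def scaleR_diff_right sum.cong sum_subtractf)
      also have "norm \<dots> \<le> (\<Sum>c\<in>C. norm ((1 / n) *\<^sub>R (y - c)))" by (rule norm_sum)
      also have "\<dots> \<le> (\<Sum>c\<in>C. (1 / n) * (if c = c0 then d - d / 2 else d))"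
      proof (rule sum_mono)
        fix c assume "c \<in> C"
        then have "norm (y - c) \<le> (if c = c0 then d - d / 2 else d)" using c0 diam y C(2) by auto
        then show "norm ((1 / n) *\<^sub>R (y - c)) \<le> (1 / n) * (if c = c0 then d - d / 2 else d)"
          using n by (simp add: divide_right_mono)
      qed
      also have "\<dots> = (1 / n) * (\<Sum>c\<in>C. d - (if c = c0 then d / 2 else 0))"
        unfolding sum_distrib_left[symmetric] by (intro arg_cong2[where f = "(*)"] sum.cong) auto
      also have "\<dots> = (1 / n) * (n * d - d / 2)"
        using C(1) c0(1) by (simp add: sum_subtractf n_def)
      also have "\<dots> = r" using n by (simp add: r_def field_simps)
      finally show ?thesis .
    qed
    define M' where "M' = M \<inter> (\<Inter>y\<in>F. cball y r)"
    have "invariant M'"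
      unfolding invariant_def
    proof (intro conjI ballI)
      show "closedin weak_topology M'"
        unfolding M'_def using M(1) x
        by (intro closedin_Int closedin_Inter) (auto simp: invariant_def closedin_weak_cball)
      show "M' \<noteq> {}" using \<open>u \<in> M\<close> ur by (auto simp: M'_def dist_norm)
      show "M' \<subseteq> K" using MK by (auto simp: M'_def)
      fix T assume T: "T \<in> \<T>"
      show "T ` M' \<subseteq> M'"
      proof clarify
        fix a assume a: "a \<in> M'"
        have "norm (y - T a) \<le> r" if "y \<in> F" for y
        proof -
          obtain y' where y': "y' \<in> F" "y = T y'" using minimal_surj[OF F(1) T] \<open>y \<in> F\<close> by blast
          have "norm (T y' - T a) \<le> norm (y' - a)" using T y' a F(2) MK by (intro nonexpansive) (auto simp: M'_def)
          also have "\<dots> \<le> r" using a y'(1) by (auto simp: M'_def dist_norm)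
          finally show ?thesis by (simp add: y')
        qed
        moreover have "T a \<in> M" using invariantD[OF M(1) T] a by (auto simp: M'_def)
        ultimately show "T a \<in> M'" by (auto simp: M'_def dist_norm)
      qed
    qed
    moreover have "convex M'" unfolding M'_def using M(2) by (intro convex_Int convex_INT convex_cball)
    ultimately have "M' = M" by (intro min) (auto simp: M'_def)
    then have "F \<subseteq> M'" using F(2) by simp
    then have "d \<le> r" unfolding d_def using x
      by (intro diameter_le) (auto simp: M'_def dist_norm)
    moreover have "d / (2 * n) > 0" using d n by simp
    ultimately show False by (simp add: r_def)
  qed
  then show ?thesis using x that[of x] inv MK F(2) by (auto simp: invariant_def)
qed

end

section \<open>Common fixed points\<close>

text \<open>The identity has to be included although the acting semigroup need not have a unit, and the identity
\<open>act (s * t) x = act s (act t x)\<close> is available on \<open>Q\<close> only; words in the generators avoid both issues.\<close>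

definition word_map :: "('s \<Rightarrow> 'a \<Rightarrow> 'a) \<Rightarrow> 's list \<Rightarrow> 'a \<Rightarrow> 'a" where
  "word_map act w = foldr (\<lambda>s f. act s \<circ> f) w id"

lemma word_map_simps [simp]:
  "word_map act [] = id" "word_map act (s # w) = act s \<circ> word_map act w"
  by (simp_all add: word_map_def)

lemma word_map_append: "word_map act (v @ w) = word_map act v \<circ> word_map act w"
  by (induction v) (auto simp: comp_assoc)

lemma nonempty_word_map_eq_act:
  assumes mult: "\<And>s t x. x \<in> Q \<Longrightarrow> act (s * t) x = act s (act t x)"
    and "w \<noteq> []"
  obtains s where "\<And>x. x \<in> Q \<Longrightarrow> word_map act w x = act (s :: 's::semigroup_mult) x"
  using assms(2)
proof (induction w arbitrary: thesis rule: list_nonempty_induct)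
  case (single s)
  then show ?case by auto
next
  case (cons s w)
  then obtain t where "\<And>x. x \<in> Q \<Longrightarrow> word_map act w x = act t x" by blast
  then show ?case by (intro cons.prems[of "s * t"]) (simp add: mult)
qed

text \<open>The maps given by words in \<open>J\<close> form a countable semigroup. On \<open>Q\<close> a nonempty word acts as a single
element, so distality of the action bounds distances below, and the empty word only contributes
\<open>norm (x - y)\<close> itself.\<close>

lemma finite_common_fixed_point:
  fixes E Q :: "'a::real_normed_vector set" and act :: "'s::semigroup_mult \<Rightarrow> 'a \<Rightarrow> 'a"
  assumes E: "compactin weak_topology E" "convex E" "bounded E" "E \<noteq> {}" "E \<subseteq> Q"
    and inv: "\<And>s. act s ` E \<subseteq> E"
    and sys: "weak_dynamical_system act Q" "nonexpansive_action act Q" "norm_distal_action act Q"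
    and J: "finite J"
  obtains x where "x \<in> E" "\<And>s. s \<in> J \<Longrightarrow> act s x = x"
proof -
  have mult: "act (s * t) x = act s (act t x)" if "x \<in> Q" for s t x
    using sys(1) that by (simp add: weak_dynamical_system_def)
  have contE: "continuous_map (subtopology weak_topology E) (subtopology weak_topology E) (act s)" for s
  proof -
    have "continuous_map (subtopology weak_topology Q) weak_topology (act s)"
      using sys(1) by (simp add: weak_dynamical_system_def continuous_map_in_subtopology)
    then show ?thesis
      using inv[of s] E(5) continuous_map_from_subtopology_mono
      by (auto simp: continuous_map_in_subtopology)
  qed
  have wordE: "word_map act w x \<in> E" if "x \<in> E" for w x
    using that inv by (induction w) (auto simp: image_subset_iff)
  interpret distal_nonexpansive_semigroup E "word_map act ` lists J"
  proof
    show "compactin weak_topology E" by (rule E(1))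
    show "countable (word_map act ` lists J)" using J by (intro countable_image countable_lists) (rule countable_finite)
    show "id \<in> word_map act ` lists J" by (rule image_eqI[of _ _ "[]"]) auto
    show "S \<circ> T \<in> word_map act ` lists J" if ST: "S \<in> word_map act ` lists J" "T \<in> word_map act ` lists J" for S T
    proof -
      obtain v w where "v \<in> lists J" "w \<in> lists J" "S = word_map act v" "T = word_map act w"
        using ST by blast
      then show ?thesis by (intro image_eqI[of _ _ "v @ w"]) (auto simp: word_map_append)
    qed
    show "continuous_map (subtopology weak_topology E) (subtopology weak_topology E) T"
      if "T \<in> word_map act ` lists J" for T
    proof -
      have "continuous_map (subtopology weak_topology E) (subtopology weak_topology E) (word_map act w)" for w
        by (induction w)
          (simp_all add: continuous_map_compose[OF _ contE, unfolded o_def] id_def o_def)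
      then show ?thesis using that by auto
    qed
    show "norm (T x - T y) \<le> norm (x - y)" if "T \<in> word_map act ` lists J" "x \<in> E" "y \<in> E" for T x y
    proof -
      have "norm (word_map act w x - word_map act w y) \<le> norm (x - y)" for w
      proof (induction w)
        case (Cons s w)
        have "norm (act s (word_map act w x) - act s (word_map act w y)) \<le> norm (word_map act w x - word_map act w y)"
          using sys(2) wordE that(2,3) E(5) unfolding nonexpansive_action_def by blast
        with Cons show ?case by simp
      qed simp
      then show ?thesis using that(1) by auto
    qed
    show "\<exists>\<delta>>0. \<forall>T\<in>word_map act ` lists J. \<delta> \<le> norm (T x - T y)" if "x \<in> E" "y \<in> E" "x \<noteq> y" for x y
    proof -
      have xyQ: "x \<in> Q" "y \<in> Q" using that E(5) by auto
      then have "0 \<notin> closure {act s x - act s y |s. True}"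
        using sys(3) that(3) by (simp add: norm_distal_action_def)
      then obtain e where e: "e > 0" "\<And>s. e \<le> norm (act s x - act s y)"
        by (force simp: closure_approachable not_less)
      have "min e (norm (x - y)) \<le> norm (word_map act w x - word_map act w y)" for w
      proof (cases "w = []")
        case False
        obtain s where "\<And>x. x \<in> Q \<Longrightarrow> word_map act w x = act s x"
          using nonempty_word_map_eq_act[of Q act w, OF mult False] by blast
        then show ?thesis using e(2)[of s] xyQ by simp
      qed simp
      then show ?thesis using e(1) that(3) by (intro exI[of _ "min e (norm (x - y))"]) auto
    qed
  qed
  obtain x where x: "x \<in> E" "\<And>T. T \<in> word_map act ` lists J \<Longrightarrow> T x = x"
    using common_fixed_point[OF E(2-4)] by blast
  show ?thesis
  proof (rule that[OF x(1)])
    fix s assume "s \<in> J"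
    then have "act s \<in> word_map act ` lists J" by (intro image_eqI[of _ _ "[s]"]) auto
    then show "act s x = x" by (rule x(2))
  qed
qed

text \<open>The fixed point sets of the single elements are weakly closed and, by the finite case, have the
finite intersection property.\<close>

lemma weakly_compact_common_fixed_point:
  fixes E Q :: "'a::real_normed_vector set" and act :: "'s::semigroup_mult \<Rightarrow> 'a \<Rightarrow> 'a"
  assumes E: "compactin weak_topology E" "convex E" "bounded E" "E \<noteq> {}" "E \<subseteq> Q"
    and inv: "\<And>s. act s ` E \<subseteq> E"
    and sys: "weak_dynamical_system act Q" "nonexpansive_action act Q" "norm_distal_action act Q"
  obtains x where "x \<in> E" "\<And>s. act s x = x"
proof -
  define Fix where "Fix s = {x \<in> E. act s x = x}" for s
  have closedE: "closedin weak_topology E" using compactin_imp_closedin[OF Hausdorff_weak_topology E(1)] .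
  have "closedin weak_topology (Fix s)" for s
  proof -
    have "continuous_map (subtopology weak_topology Q) weak_topology (act s)"
      using sys(1) by (simp add: weak_dynamical_system_def continuous_map_in_subtopology)
    then have "continuous_map (subtopology weak_topology E) weak_topology (act s)"
      using E(5) by (rule continuous_map_from_subtopology_mono)
    then have "closedin (subtopology weak_topology E) {x \<in> topspace (subtopology weak_topology E). act s x = x}"
      by (intro closedin_continuous_maps_eq[OF Hausdorff_weak_topology]) (auto intro: continuous_map_from_subtopology)
    then show ?thesis using closedE by (auto simp: Fix_def intro: closedin_trans_full)
  qed
  moreover have "E \<inter> \<Inter>\<F> \<noteq> {}" if fin: "finite \<F>" and sub: "\<F> \<subseteq> range Fix" for \<F>
  proof -
    obtain J where J: "finite J" "\<F> = Fix ` J" using fin sub by (meson finite_subset_image)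
    obtain x where x: "x \<in> E" "\<And>s. s \<in> J \<Longrightarrow> act s x = x"
      using finite_common_fixed_point[OF E inv sys J(1)] by blast
    then have "x \<in> E \<inter> \<Inter>\<F>" by (auto simp: J(2) Fix_def)
    then show ?thesis by blast
  qed
  ultimately have "E \<inter> \<Inter>(range Fix) \<noteq> {}"
    using E(1) unfolding compactin_fip by blast
  then show ?thesis using that by (auto simp: Fix_def)
qed

theorem theorem5p3:
  fixes Q A :: "'a::banach set"
    and act :: "'s::semigroup_mult \<Rightarrow> 'a \<Rightarrow> 'a"
  assumes "bounded Q" and "convex Q" and "L_embedded Q"
    and "weak_dynamical_system act Q"
    and "nonexpansive_action act Q"
    and "norm_distal_action act Q"
    and "A \<subseteq> Q" and "A \<noteq> {}" and "bounded A"
    and "\<And>s. act s ` A = A"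
  shows "\<exists>x\<in>chebyshev_center Q A. \<forall>s. act s x = x"
proof -
  define r where "r = chebyshev_radius Q A"
  define E where "E = chebyshev_center Q A"
  note center = chebyshev_center_L_embedded[OF assms(3,8,9), folded E_def r_def]
  have E_balls: "E = Q \<inter> (\<Inter>y\<in>A. cball y r)"
    using assms(8) by (auto simp: center(1) dist_norm norm_minus_commute)
  have "convex E" unfolding E_balls by (intro convex_Int convex_INT convex_cball assms(2))
  have EQ: "E \<subseteq> Q" unfolding E_balls by blast
  have "bounded E" using EQ assms(1) bounded_subset by blast
  have "act s ` E \<subseteq> E" for s
  proof clarify
    fix x assume x: "x \<in> E"
    then have xQ: "x \<in> Q" using EQ by auto
    have "act s x \<in> Q"
      using assms(4) xQ by (auto simp: weak_dynamical_system_def continuous_map_in_subtopology image_subset_iff Pi_iff)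
    moreover have "norm (act s x - y) \<le> r" if "y \<in> A" for y
    proof -
      obtain y' where y': "y' \<in> A" "y = act s y'" using assms(10)[of s] \<open>y \<in> A\<close> by blast
      have "norm (act s x - act s y') \<le> norm (x - y')"
        using assms(5,7) xQ y'(1) by (auto simp: nonexpansive_action_def)
      also have "\<dots> \<le> r" using x y'(1) by (simp add: center(1))
      finally show ?thesis by (simp add: y')
    qed
    ultimately show "act s x \<in> E" by (simp add: center(1))
  qed
  then obtain x where "x \<in> E" "\<And>s. act s x = x"
    using weakly_compact_common_fixed_point[OF center(3) \<open>convex E\<close> \<open>bounded E\<close> center(2) EQ _ assms(4-6)] by blast
  then show ?thesis by (auto simp: E_def)
qed

end
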